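(* Let $0<T<\infty$ and $(\eta_0,u_0)\in H^1\times (H^2\cap H^1_0)$. Then the system of integral equations $$\eta(x,t)=\eta_0(x)+\int_0^t \left[ L_N\!\left(\tfrac{a+b}{b}u+\eta u\right)+\tfrac{a}{b}u_x \right] d\tau,\qquad u(x,t)=u_0(x)+\int_0^t L_D\!\left(\eta+\tfrac{1}{2}u^2\right)d\tau$$ has at most one solution $(\eta,u)\in H^1_T\times H^2_T$.
   Context: Fix $L>0$ and real parameters $a<0$, $b>0$, $d>0$ with $a+b+d=\tfrac13$. $L^2=L^2(-L,L)$ and $H^s=H^s(-L,L)$ are the real Lebesgue/Sobolev spaces with norms $\|v\|$ and $\|v\|_s=\left(\sum_{j=0}^s\|\partial_x^jv\|^2\right)^{1/2}$; $H^1_0=\{v\in H^1: v(L)=v(-L)=0\}$. Set $H^1_T:=C(0,T;H^1)$ and $H^2_T:=C(0,T;H^2\cap H^1_0)$ (continuous functions of $t\in[0,T]$ with values in the indicated space), with norms $\|u\|_{H^s_T}=\sup_{0\le t\le T}\|u(\cdot,t)\|_s$. The operator $L_N$ is defined by $(L_Nf)(x)=\int_{-L}^{L}F_\xi(x,\xi)f(\xi)\,d\xi$, where $F_\xi=\partial F/\partial\xi$, $$F(x,\xi)=-\frac{1}{bW}\begin{cases}\omega_1(\xi)\omega_2(x), & -L\le\xi\le x,\\ \omega_1(x)\omega_2(\xi), & x<\xi\le L,\end{cases}$$ $\omega_1(x)=\cosh\left(\frac{L+x}{\sqrt b}\right)$, $\omega_2(x)=\cosh\left(\frac{L-x}{\sqrt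 b}\right)$, $W=-\frac{1}{\sqrt b}\sinh\left(\frac{2L}{\sqrt b}\right)$ ($F$ is the Green's function of $w-bw_{xx}=-f_x$, $w_x(\pm L)=0$). The operator $L_D$ is defined by $(L_Df)(x)=\int_{-L}^{L}G_\xi(x,\xi)f(\xi)\,d\xi$, where $G$ is given by the same formula with $b$ replaced by $d$, $\omega_1(x)=\sinh\left(\frac{L+x}{\sqrt d}\right)$, $\omega_2(x)=\sinh\left(\frac{L-x}{\sqrt d}\right)$, $W=-\frac{1}{\sqrt d}\sinh\left(\frac{2L}{\sqrt d}\right)$ ($G$ is the Green's function of $w-dw_{xx}=-f_x$, $w(\pm L)=0$). Both operators act in the variable $x$ at each fixed time. *)

theory Defs
  imports "HOL-Analysis.Analysis"
begin

text \<open>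
  Elements of the Lebesgue and Sobolev spaces on the interval from -L to L are represented by
  functions on the reals: values outside the interval are irrelevant, and two functions represent
  the same element iff they agree almost everywhere on the interval.
\<close>

abbreviation leb :: "real \<Rightarrow> real measure" where
  "leb L \<equiv> lebesgue_on {-L<..<L}"

definition L2 :: "real \<Rightarrow> (real \<Rightarrow> real) set" where
  "L2 L = {v \<in> borel_measurable (leb L). integrable (leb L) (\<lambda>x. (v x)\<^sup>2)}"

definition L2_norm :: "real \<Rightarrow> (real \<Rightarrow> real) \<Rightarrow> real" where
  "L2_norm L v = sqrt (LINT x|leb L. (v x)\<^sup>2)"

definition test_functions :: "real \<Rightarrow> (real \<Rightarrow> real) set" where
  "test_functions L = {\<phi>. (\<forall>k x. (deriv ^^ k) \<phi> differentiable (at x)) \<and>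
     compact (closure {x. \<phi> x \<noteq> 0}) \<and> closure {x. \<phi> x \<noteq> 0} \<subseteq> {-L<..<L}}"

definition is_weak_deriv :: "real \<Rightarrow> nat \<Rightarrow> (real \<Rightarrow> real) \<Rightarrow> (real \<Rightarrow> real) \<Rightarrow> bool" where
  "is_weak_deriv L j v w \<longleftrightarrow> (\<forall>\<phi>\<in>test_functions L.
     (LINT x|leb L. v x * (deriv ^^ j) \<phi> x) = (-1) ^ j * (LINT x|leb L. w x * \<phi> x))"

definition sobolev :: "nat \<Rightarrow> real \<Rightarrow> (real \<Rightarrow> real) set" where
  "sobolev s L = {v \<in> L2 L. \<forall>j\<le>s. \<exists>w\<in>L2 L. is_weak_deriv L j v w}"

text \<open>The weak derivative is determined only up to null sets.\<close>

definition weak_deriv :: "real \<Rightarrow> nat \<Rightarrow> (real \<Rightarrow> real) \<Rightarrow> real \<Rightarrow> real" where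
  "weak_deriv L j v = (SOME w. w \<in> L2 L \<and> is_weak_deriv L j v w)"

definition sobolev_norm :: "nat \<Rightarrow> real \<Rightarrow> (real \<Rightarrow> real) \<Rightarrow> real" where
  "sobolev_norm s L v = sqrt (\<Sum>j\<le>s. (L2_norm L (weak_deriv L j v))\<^sup>2)"

text \<open>
  The representative continuous up to the boundary, which exists for every element of the first
  order Sobolev space and is unique on the closed interval. It gives a meaning to point values.
\<close>

definition cont_rep :: "real \<Rightarrow> (real \<Rightarrow> real) \<Rightarrow> real \<Rightarrow> real" where
  "cont_rep L v = (SOME w. continuous_on {-L..L} w \<and> (AE x in leb L. w x = v x))"

definition H10 :: "real \<Rightarrow> (real \<Rightarrow> real) set" where
  "H10 L = {v \<in> sobolev 1 L. cont_rep L v L = 0 \<and> cont_rep L v (-L) = 0}"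

text \<open>
  Functions of time and space take the time as their first argument. Below, X is a subset of the
  Sobolev space of order s, carrying its norm.
\<close>

definition cont_time :: "nat \<Rightarrow> real \<Rightarrow> real \<Rightarrow> (real \<Rightarrow> real) set \<Rightarrow> (real \<Rightarrow> real \<Rightarrow> real) set" where
  "cont_time s L T X = {f. (\<forall>t\<in>{0..T}. f t \<in> X) \<and>
     (\<forall>t\<in>{0..T}. ((\<lambda>r. sobolev_norm s L (\<lambda>x. f r x - f t x)) \<longlongrightarrow> 0) (at t within {0..T}))}"

definition H1T :: "real \<Rightarrow> real \<Rightarrow> (real \<Rightarrow> real \<Rightarrow> real) set" where
  "H1T L T = cont_time 1 L T (sobolev 1 L)"

definition H2T :: "real \<Rightarrow> real \<Rightarrow> (real \<Rightarrow> real \<Rightarrow> real) set" where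
  "H2T L T = cont_time 2 L T (sobolev 2 L \<inter> H10 L)"

definition green_F :: "real \<Rightarrow> real \<Rightarrow> real \<Rightarrow> real \<Rightarrow> real" where
  "green_F b L x \<xi> =
    (let \<omega>1 = (\<lambda>y. cosh ((L + y) / sqrt b));
         \<omega>2 = (\<lambda>y. cosh ((L - y) / sqrt b));
         W = - (1 / sqrt b) * sinh (2 * L / sqrt b)
     in - (1 / (b * W)) * (if \<xi> \<le> x then \<omega>1 \<xi> * \<omega>2 x else \<omega>1 x * \<omega>2 \<xi>))"

definition green_G :: "real \<Rightarrow> real \<Rightarrow> real \<Rightarrow> real \<Rightarrow> real" where
  "green_G d L x \<xi> =
    (let \<omega>1 = (\<lambda>y. sinh ((L + y) / sqrt d));
         \<omega>2 = (\<lambda>y. sinh ((L - y) / sqrt d));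
         W = - (1 / sqrt d) * sinh (2 * L / sqrt d)
     in - (1 / (d * W)) * (if \<xi> \<le> x then \<omega>1 \<xi> * \<omega>2 x else \<omega>1 x * \<omega>2 \<xi>))"

text \<open>
  The kernels are not differentiable in their second argument at the single point where both
  arguments coincide; the value of the derivative there does not affect the integrals.
\<close>

definition LN :: "real \<Rightarrow> real \<Rightarrow> (real \<Rightarrow> real) \<Rightarrow> real \<Rightarrow> real" where
  "LN b L f x = (LINT \<xi>|leb L. deriv (green_F b L x) \<xi> * f \<xi>)"

definition LD :: "real \<Rightarrow> real \<Rightarrow> (real \<Rightarrow> real) \<Rightarrow> real \<Rightarrow> real" where
  "LD d L f x = (LINT \<xi>|leb L. deriv (green_G d L x) \<xi> * f \<xi>)"

text \<open>
  All terms of the integral equations are evaluated through continuous representatives, so that the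
  equations hold at every point and the time integrals are integrals of continuous functions. The
  operators LN and LD do not depend on the representative of their argument and have continuous
  values.
\<close>

definition is_solution ::
  "real \<Rightarrow> real \<Rightarrow> real \<Rightarrow> real \<Rightarrow> real \<Rightarrow> (real \<Rightarrow> real) \<Rightarrow> (real \<Rightarrow> real) \<Rightarrow>
   (real \<Rightarrow> real \<Rightarrow> real) \<Rightarrow> (real \<Rightarrow> real \<Rightarrow> real) \<Rightarrow> bool" where
  "is_solution a b d L T \<eta>0 u0 \<eta> u \<longleftrightarrow>
     (\<forall>t\<in>{0..T}. \<forall>x\<in>{-L..L}.
        cont_rep L (\<eta> t) x = cont_rep L \<eta>0 x +
          (LINT \<tau>:{0..t}|lebesgue.
             LN b L (\<lambda>\<xi>. (a + b) / b * u \<tau> \<xi> + \<eta> \<tau> \<xi> * u \<tau> \<xi>) x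
             + a / b * cont_rep L (weak_deriv L 1 (u \<tau>)) x) \<and>
        cont_rep L (u t) x = cont_rep L u0 x +
          (LINT \<tau>:{0..t}|lebesgue. LD d L (\<lambda>\<xi>. \<eta> \<tau> \<xi> + 1 / 2 * (u \<tau> \<xi>)\<^sup>2) x))"

end

theory Submission
  imports Defs
begin

text \<open>
  Consider the differences of two solutions: \<open>e\<close> of the surface elevations, \<open>w\<close> of the velocities, and
  \<open>w\<^sub>x\<close>, all taken through continuous representatives, which are jointly continuous in time and space
  by the Sobolev embedding and hence bounded. The kernels of both integral operators are bounded, which controls
  \<open>e\<close> and \<open>w\<close> by the time integral of the supremum norms of \<open>e\<close>, \<open>w\<close> and \<open>w\<^sub>x\<close>. The term \<open>u\<^sub>x\<close> in
  the first equation seems to lose a derivative, but the second operator maps bounded functions to Lipschitz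
  functions, so the second equation bounds the Lipschitz constant of \<open>w\<close>, which is the supremum of
  \<open>w\<^sub>x\<close>, by the same integral. Iterating the resulting inequality bounds all three differences by
  \<open>B (C t)\<^sup>n / n!\<close> for every \<open>n\<close>.
\<close>

section \<open>Smooth bump functions\<close>

text \<open>Weak derivatives and continuous representatives enter the statement through a choice
  operator, so nothing can be computed from them before they are known to be unique up to null sets.
  This is what the bump functions, the lemma of du Bois-Reymond and the one-dimensional Sobolev
  embedding are for. The estimate closes in the suprema of \<open>e\<close>, \<open>w\<close> and
  the derivative of \<open>w\<close>; neither the derivative of \<open>e\<close> nor the second
  derivative of \<open>w\<close> has to be controlled, and no integral over time is ever
  differentiated in space. The gain of one derivative in the second operator is not evident from its
  kernel, which jumps across the diagonal and so is not Lipschitz in x. Between two points y < z,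
  however, the jump concerns only those \<xi> that lie between them. Against a bounded function this
  contributes a multiple of z - y, the same order as the smooth part of the kernel.\<close>

text \<open>Polynomial factors in \<open>1 / x\<close> make this family closed under differentiation.\<close>

definition flat :: "real \<Rightarrow> real poly \<Rightarrow> real \<Rightarrow> real" where
  "flat c p x = (if x > 0 then poly p (1 / x) * exp (- c / x) else 0)"

text \<open>Induction over the Horner form of \<open>p\<close>. The decay is shared out: one factor
  \<open>exp (- (c / 2 * y))\<close> absorbs the additional power of \<open>y\<close>, the other one
  goes to the induction hypothesis, which is why \<open>c\<close> must be arbitrary.\<close>

lemma poly_exp_tendsto_0:
  fixes p :: "real poly"
  assumes "c > 0"
  shows "((\<lambda>y. poly p y * exp (- (c * y))) \<longlongrightarrow> 0) at_top"
  using assms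
proof (induction p arbitrary: c)
  case 0
  then show ?case by simp
next
  case (pCons a p)
  have scale: "filterlim (\<lambda>y. c * y) at_top at_top" if "c > 0" for c :: real
    by (rule filterlim_tendsto_pos_mult_at_top[OF tendsto_const that filterlim_ident])
  have exp0: "((\<lambda>y. exp (- (c * y))) \<longlongrightarrow> 0) at_top" if "c > 0" for c :: real
    using filterlim_compose[OF exp_at_bot filterlim_compose[OF filterlim_uminus_at_bot_at_top scale[OF that]]]
    by simp
  have lin: "((\<lambda>y. y * exp (- (c * y))) \<longlongrightarrow> 0) at_top" if "c > 0" for c :: real
  proof -
    have "((\<lambda>y. 1 / c * ((c * y) ^ 1 / exp (c * y))) \<longlongrightarrow> 1 / c * 0) at_top"
      by (intro tendsto_mult tendsto_const filterlim_compose[OF tendsto_power_div_exp_0 scale] that)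
    then show ?thesis
      using that by (simp add: exp_minus field_simps)
  qed
  have "((\<lambda>y. a * exp (- (c * y)) + (y * exp (- (c / 2 * y))) * (poly p y * exp (- (c / 2 * y))))
      \<longlongrightarrow> a * 0 + 0 * 0) at_top"
    using pCons.prems by (intro tendsto_add tendsto_mult tendsto_const exp0 lin pCons.IH) auto
  moreover have "a * exp (- (c * y)) + (y * exp (- (c / 2 * y))) * (poly p y * exp (- (c / 2 * y)))
      = poly (pCons a p) y * exp (- (c * y))" for y
  proof -
    have "exp (- (c / 2 * y)) * exp (- (c / 2 * y)) = exp (- (c * y))"
      by (simp flip: exp_add)
    then show ?thesis by (simp add: algebra_simps)
  qed
  ultimately show ?case by simp
qed

text \<open>With y = 1 / x the chain rule contributes the factor -y^2 to the derivative of
  \<open>p\<close> and c y^2 from the exponential, which explains the polynomial in the statement.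
  At the origin the difference quotient from the right belongs to the same family, with y p(y) in
  place of p(y), and therefore tends to 0.\<close>

lemma flat_DERIV:
  assumes "c > 0"
  shows "(flat c p has_real_derivative flat c ([:0, 0, 1:] * (smult c p - pderiv p)) x) (at x)"
proof -
  consider "x > 0" | "x < 0" | "x = 0" by linarith
  then show ?thesis
  proof cases
    case 1
    have "((\<lambda>x. poly p (1 / x) * exp (- c / x)) has_real_derivative
        flat c ([:0, 0, 1:] * (smult c p - pderiv p)) x) (at x)"
    proof -
      have i: "((\<lambda>x. 1 / x) has_real_derivative - (1 / x\<^sup>2)) (at x)"
        using 1 by (auto intro!: derivative_eq_intros simp: power2_eq_square)
      have e: "((\<lambda>x. exp (- c / x)) has_real_derivative exp (- c / x) * (c / x\<^sup>2)) (at x)"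
        using 1 by (auto intro!: derivative_eq_intros simp: power2_eq_square)
      show ?thesis
        by (rule DERIV_cong[OF DERIV_mult[OF DERIV_chain'[OF i poly_DERIV] e]])
          (use 1 in \<open>simp add: flat_def divide_inverse power2_eq_square algebra_simps\<close>)
    qed
    moreover have "\<forall>\<^sub>F y in nhds x. flat c p y = poly p (1 / y) * exp (- c / y)"
      using eventually_nhds_in_open[of "{0<..}" x] 1 by (auto elim!: eventually_mono simp: flat_def)
    ultimately show ?thesis
      by (simp only: DERIV_cong_ev[OF refl _ refl])
  next
    case 2
    have "\<forall>\<^sub>F y in nhds x. flat c p y = 0"
      using eventually_nhds_in_open[of "{..<0}" x] 2 by (auto elim!: eventually_mono simp: flat_def)
    then have "(flat c p has_real_derivative 0) (at x)"
      by (simp only: DERIV_cong_ev[OF refl _ refl] DERIV_const)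
    then show ?thesis
      using 2 by (simp add: flat_def)
  next
    case 3
    have r: "((\<lambda>h. flat c p h / h) \<longlongrightarrow> 0) (at_right 0)"
    proof -
      have "((\<lambda>h. poly ([:0, 1:] * p) (inverse h) * exp (- (c * inverse h))) \<longlongrightarrow> 0) (at_right 0)"
        by (rule filterlim_compose[OF poly_exp_tendsto_0[OF assms] filterlim_inverse_at_top_right])
      moreover have "\<forall>\<^sub>F h in at_right 0. poly ([:0, 1:] * p) (inverse h) * exp (- (c * inverse h))
          = flat c p h / h"
        using eventually_at_right_less[of 0]
        by (rule eventually_mono) (simp add: flat_def divide_inverse)
      ultimately show ?thesis
        by (rule Lim_transform_eventually)
    qed
    have l: "((\<lambda>h. flat c p h / h) \<longlongrightarrow> 0) (at_left 0)"
    proof (rule tendsto_eventually)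
      show "\<forall>\<^sub>F h in at_left 0. flat c p h / h = 0"
        unfolding eventually_at_filter by (rule always_eventually) (simp add: flat_def)
    qed
    have "((\<lambda>h. (flat c p (0 + h) - flat c p 0) / h) \<longlongrightarrow> 0) (at 0)"
      using l r by (simp add: filterlim_at_split flat_def[of c p 0])
    then show ?thesis
      using 3 by (simp add: DERIV_def flat_def)
  qed
qed

text \<open>Leibniz' rule turns a product of two flat functions into a sum of such products, so
  closure under differentiation forces closure under addition. The sign produced by the reflected
  argument \<open>\<beta> - x\<close> is absorbed by the polynomial.\<close>

inductive_set flat_products :: "real \<Rightarrow> real \<Rightarrow> real \<Rightarrow> (real \<Rightarrow> real) set" for c \<alpha> \<beta> where
  prod: "(\<lambda>x. flat c p (x - \<alpha>) * flat c q (\<beta> - x)) \<in> flat_products c \<alpha> \<beta>"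
| add: "f \<in> flat_products c \<alpha> \<beta> \<Longrightarrow> g \<in> flat_products c \<alpha> \<beta> \<Longrightarrow> (\<lambda>x. f x + g x) \<in> flat_products c \<alpha> \<beta>"

lemma flat_products_DERIV:
  assumes "c > 0" "f \<in> flat_products c \<alpha> \<beta>"
  shows "\<exists>f'\<in>flat_products c \<alpha> \<beta>. \<forall>x. (f has_real_derivative f' x) (at x)"
  using assms(2)
proof induction
  case (prod p q)
  let ?D = "\<lambda>p. [:0, 0, 1:] * (smult c p - pderiv p)"
  have neg: "flat c (- p) x = - flat c p x" for p x
    by (simp add: flat_def)
  have "((\<lambda>x. flat c p (x - \<alpha>) * flat c q (\<beta> - x)) has_real_derivative
      flat c (?D p) (x - \<alpha>) * flat c q (\<beta> - x) + flat c p (x - \<alpha>) * flat c (- ?D q) (\<beta> - x)) (at x)" for x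
  proof -
    have "((\<lambda>x. flat c p (x - \<alpha>)) has_real_derivative flat c (?D p) (x - \<alpha>) * (1 - 0)) (at x)"
      by (rule DERIV_chain'[OF DERIV_diff[OF DERIV_ident DERIV_const] flat_DERIV[OF assms(1)]])
    then have 1: "((\<lambda>x. flat c p (x - \<alpha>)) has_real_derivative flat c (?D p) (x - \<alpha>)) (at x)"
      by simp
    have "((\<lambda>x. flat c q (\<beta> - x)) has_real_derivative flat c (?D q) (\<beta> - x) * (0 - 1)) (at x)"
      by (rule DERIV_chain'[OF DERIV_diff[OF DERIV_const DERIV_ident] flat_DERIV[OF assms(1)]])
    then have 2: "((\<lambda>x. flat c q (\<beta> - x)) has_real_derivative flat c (- ?D q) (\<beta> - x)) (at x)"
      unfolding neg by simp
    show ?thesis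
      using DERIV_mult[OF 1 2] by (simp add: algebra_simps)
  qed
  then show ?case
    by (intro bexI[OF _ flat_products.add[OF flat_products.prod flat_products.prod]] allI)
next
  case (add f g)
  then obtain f' g' where "f' \<in> flat_products c \<alpha> \<beta>" "\<forall>x. (f has_real_derivative f' x) (at x)"
    "g' \<in> flat_products c \<alpha> \<beta>" "\<forall>x. (g has_real_derivative g' x) (at x)"
    by blast
  then show ?case
    by (intro bexI[where x = "\<lambda>x. f' x + g' x"] allI DERIV_add flat_products.add) auto
qed

text \<open>Smoothness of test functions is phrased through iterates of \<open>deriv\<close>. A
  class closed under differentiation contains all these iterates, so one derivative rule for the
  class is enough.\<close>

lemma higher_deriv_differentiable:
  assumes closed: "\<And>f. f \<in> S \<Longrightarrow> \<exists>f'\<in>S. \<forall>x. (f has_real_derivative f' x) (at x)"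
    and "f \<in> S"
  shows "(deriv ^^ k) f differentiable (at x)"
proof -
  have "(deriv ^^ k) f \<in> S" for k
  proof (induction k)
    case (Suc k)
    obtain f' where f': "f' \<in> S" "\<forall>x. ((deriv ^^ k) f has_real_derivative f' x) (at x)"
      using closed[OF Suc] by blast
    then have "deriv ((deriv ^^ k) f) = f'"
      by (auto intro!: DERIV_imp_deriv)
    with f' show ?case by simp
  qed (use assms in simp)
  from closed[OF this, of k] show ?thesis
    using real_differentiable_def by blast
qed

text \<open>
  The \<open>n + 1\<close>-st root of a bump function is again smooth, and these roots increase to the indicator
  function of the interval, so no mollification is needed to approximate indicator functions.
\<close>

definition plateau :: "real \<Rightarrow> real \<Rightarrow> nat \<Rightarrow> real \<Rightarrow> real" where
  "plateau \<alpha> \<beta> n x = flat (1 / Suc n) 1 (x - \<alpha>) * flat (1 / Suc n) 1 (\<beta> - x)"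

lemma plateau_bounds: "0 \<le> plateau \<alpha> \<beta> n x" "plateau \<alpha> \<beta> n x \<le> 1"
proof -
  have f: "0 \<le> flat (1 / Suc n) 1 y" "flat (1 / Suc n) 1 y \<le> 1" for y
    by (auto simp: flat_def field_simps)
  show "0 \<le> plateau \<alpha> \<beta> n x" "plateau \<alpha> \<beta> n x \<le> 1"
    unfolding plateau_def using f by (auto intro!: mult_le_one)
qed

lemma plateau_eq_0: "x \<notin> {\<alpha><..<\<beta>} \<Longrightarrow> plateau \<alpha> \<beta> n x = 0"
  by (auto simp: plateau_def flat_def)

lemma plateau_pos: "x \<in> {\<alpha><..<\<beta>} \<Longrightarrow> plateau \<alpha> \<beta> n x > 0"
  by (auto simp: plateau_def flat_def)

lemma plateau_tendsto: "(\<lambda>n. plateau \<alpha> \<beta> n x) \<longlonglongrightarrow> indicator {\<alpha><..<\<beta>} x"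
proof (cases "x \<in> {\<alpha><..<\<beta>}")
  case True
  have e: "(\<lambda>n. exp (- (1 / real (Suc n)) / y)) \<longlonglongrightarrow> exp (- 0 / y)" if "y > 0" for y :: real
    using LIMSEQ_inverse_real_of_nat that
    by (intro tendsto_exp tendsto_divide tendsto_minus tendsto_const) (auto simp: divide_inverse)
  have "(\<lambda>n. exp (- (1 / real (Suc n)) / (x - \<alpha>)) * exp (- (1 / real (Suc n)) / (\<beta> - x)))
      \<longlonglongrightarrow> exp (- 0 / (x - \<alpha>)) * exp (- 0 / (\<beta> - x))"
    using True by (intro tendsto_mult e) auto
  then show ?thesis
    using True by (simp add: plateau_def flat_def)
qed (simp add: plateau_eq_0)

lemma plateau_test_functions:
  assumes "-L < \<alpha>" "\<beta> < L"
  shows "plateau \<alpha> \<beta> n \<in> test_functions L"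
proof -
  have "plateau \<alpha> \<beta> n \<in> flat_products (1 / Suc n) \<alpha> \<beta>"
    using flat_products.prod[of "1 / Suc n" 1 \<alpha> 1 \<beta>] by (simp add: plateau_def[abs_def])
  then have "\<forall>k x. (deriv ^^ k) (plateau \<alpha> \<beta> n) differentiable (at x)"
    by (intro allI higher_deriv_differentiable[where S = "flat_products (1 / Suc n) \<alpha> \<beta>"]
        flat_products_DERIV) auto
  moreover have sub: "closure {x. plateau \<alpha> \<beta> n x \<noteq> 0} \<subseteq> {\<alpha>..\<beta>}"
  proof (rule closure_minimal)
    show "{x. plateau \<alpha> \<beta> n x \<noteq> 0} \<subseteq> {\<alpha>..\<beta>}"
    proof
      fix x assume "x \<in> {x. plateau \<alpha> \<beta> n x \<noteq> 0}"
      then show "x \<in> {\<alpha>..\<beta>}"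
        using plateau_eq_0[of x \<alpha> \<beta> n] by (cases "x \<in> {\<alpha><..<\<beta>}") auto
    qed
  qed simp
  moreover have "compact (closure {x. plateau \<alpha> \<beta> n x \<noteq> 0})"
    using sub bounded_subset[OF bounded_closed_interval] compact_eq_bounded_closed by blast
  moreover have "{\<alpha>..\<beta>} \<subseteq> {-L<..<L}"
    using assms by auto
  ultimately show ?thesis
    unfolding test_functions_def by blast
qed

section \<open>Test functions\<close>

text \<open>Link between the Lebesgue integral over the whole interval and the gauge integral over
  subintervals, for which the fundamental theorem of calculus and the splitting of intervals are
  available.\<close>

lemma integral_leb_interval:
  fixes f :: "real \<Rightarrow> real"
  assumes "integrable (leb L) f" "-L \<le> \<alpha>" "\<beta> \<le> L"
  shows "(LINT x|leb L. indicator {\<alpha><..<\<beta>} x * f x) = integral {\<alpha>..\<beta>} f"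
    and "f absolutely_integrable_on {\<alpha>..\<beta>}"
proof -
  have sub: "{\<alpha><..<\<beta>} \<subseteq> {-L<..<L}"
    using assms by auto
  have i: "integrable lebesgue (\<lambda>x. indicator {-L<..<L} x *\<^sub>R f x)"
    using assms(1) by (simp add: integrable_restrict_space)
  have "integrable lebesgue (\<lambda>x. indicator {\<alpha><..<\<beta>} x *\<^sub>R (indicator {-L<..<L} x *\<^sub>R f x))"
    by (intro integrable_mult_indicator i) auto
  moreover have eq: "indicator {\<alpha><..<\<beta>} x *\<^sub>R (indicator {-L<..<L} x *\<^sub>R f x) = indicator {\<alpha><..<\<beta>} x *\<^sub>R f x" for x
    using sub by (auto simp: indicator_def)
  ultimately have j: "integrable lebesgue (\<lambda>x. indicator {\<alpha><..<\<beta>} x *\<^sub>R f x)"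
    by (simp only: eq)
  then have k: "integrable (lebesgue_on {\<alpha><..<\<beta>}) f"
    by (simp add: integrable_restrict_space)
  have "(LINT x|leb L. indicator {\<alpha><..<\<beta>} x * f x)
      = (LINT x|lebesgue. indicator {-L<..<L} x *\<^sub>R (indicator {\<alpha><..<\<beta>} x * f x))"
    by (simp add: integral_restrict_space)
  also have "\<dots> = (LINT x|lebesgue. indicator {\<alpha><..<\<beta>} x *\<^sub>R f x)"
    by (rule Bochner_Integration.integral_cong) (use sub in \<open>auto simp: indicator_def\<close>)
  also have "\<dots> = (LINT x|lebesgue_on {\<alpha><..<\<beta>}. f x)"
    by (simp add: integral_restrict_space)
  also have "\<dots> = integral {\<alpha><..<\<beta>} f"
    by (rule lebesgue_integral_eq_integral[OF k]) auto
  also have "\<dots> = integral {\<alpha>..\<beta>} f"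
    by (rule integral_open_interval_real[symmetric])
  finally show "(LINT x|leb L. indicator {\<alpha><..<\<beta>} x * f x) = integral {\<alpha>..\<beta>} f" .
  have "f absolutely_integrable_on {\<alpha><..<\<beta>}"
    using j by (simp add: absolutely_integrable_on_def set_integrable_def)
  then show "f absolutely_integrable_on {\<alpha>..\<beta>}"
    by (simp add: absolutely_integrable_on_Icc_iff_Ioo)
qed

lemma finite_measure_leb: "finite_measure (leb L)"
  by (intro finite_measure_lebesgue_on) simp

lemma integrable_L2: "v \<in> L2 L \<Longrightarrow> integrable (leb L) v"
  using finite_measure.square_integrable_imp_integrable[OF finite_measure_leb]
  by (auto simp: L2_def)

lemma integrable_mult_bounded:
  fixes f g :: "'a \<Rightarrow> real"
  assumes "integrable M f" "g \<in> borel_measurable M" "\<And>x. x \<in> space M \<Longrightarrow> \<bar>g x\<bar> \<le> B"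
  shows "integrable M (\<lambda>x. f x * g x)"
proof (rule Bochner_Integration.integrable_bound)
  show "integrable M (\<lambda>x. B * f x)"
    using assms(1) by simp
  show "(\<lambda>x. f x * g x) \<in> borel_measurable M"
    using assms by measurable
  show "AE x in M. norm (f x * g x) \<le> norm (B * f x)"
  proof (rule AE_I2)
    fix x assume "x \<in> space M"
    from assms(3)[OF this] have "\<bar>f x\<bar> * \<bar>g x\<bar> \<le> \<bar>f x\<bar> * \<bar>B\<bar>"
      by (intro mult_left_mono) auto
    then show "norm (f x * g x) \<le> norm (B * f x)"
      by (simp add: abs_mult mult.commute)
  qed
qed

lemma borel_measurable_leb_continuous:
  fixes f :: "real \<Rightarrow> real"
  assumes "continuous_on {-L..L} f"
  shows "f \<in> borel_measurable (leb L)"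
proof (rule continuous_imp_measurable_on_sets_lebesgue)
  show "continuous_on {-L<..<L} f"
    by (rule continuous_on_subset[OF assms]) auto
qed simp

lemma test_function_DERIV:
  assumes "\<phi> \<in> test_functions L"
  shows "(\<phi> has_real_derivative deriv \<phi> x) (at x)"
proof -
  have "(deriv ^^ 0) \<phi> differentiable (at x)"
    using assms unfolding test_functions_def by blast
  then show ?thesis
    using DERIV_deriv_iff_real_differentiable by simp
qed

lemma test_function_continuous:
  "\<phi> \<in> test_functions L \<Longrightarrow> continuous_on S \<phi>"
  by (meson DERIV_isCont continuous_at_imp_continuous_on test_function_DERIV)

text \<open>The extreme points of the compact support keep a positive distance from the ends of the
  interval. The zero function forms a separate case because an empty support has no extreme
  points.\<close>

lemma test_function_support:
  assumes "\<phi> \<in> test_functions L"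
  obtains \<alpha> \<beta> where "-L < \<alpha>" "\<alpha> \<le> \<beta>" "\<beta> < L" "\<And>x. x \<notin> {\<alpha>..\<beta>} \<Longrightarrow> \<phi> x = 0"
    | "\<And>x. \<phi> x = 0"
proof (cases "{x. \<phi> x \<noteq> 0} = {}")
  case False
  let ?K = "closure {x. \<phi> x \<noteq> 0}"
  have K: "compact ?K" "?K \<subseteq> {-L<..<L}" "?K \<noteq> {}"
    using assms False by (auto simp: test_functions_def)
  obtain \<alpha> where \<alpha>: "\<alpha> \<in> ?K" "\<And>x. x \<in> ?K \<Longrightarrow> \<alpha> \<le> x"
    using compact_attains_inf[OF K(1,3)] by blast
  obtain \<beta> where \<beta>: "\<beta> \<in> ?K" "\<And>x. x \<in> ?K \<Longrightarrow> x \<le> \<beta>"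
    using compact_attains_sup[OF K(1,3)] by blast
  have "x \<in> {\<alpha>..\<beta>}" if "\<phi> x \<noteq> 0" for x
    using \<alpha>(2) \<beta>(2) closure_subset[of "{x. \<phi> x \<noteq> 0}"] that by auto
  then have "\<phi> x = 0" if "x \<notin> {\<alpha>..\<beta>}" for x
    using that by blast
  moreover have "\<alpha> \<in> {-L<..<L}" "\<beta> \<in> {-L<..<L}" "\<alpha> \<le> \<beta>"
    using \<alpha> \<beta>(1) K(2) by blast+
  ultimately show thesis
    by (intro that(1)[of \<alpha> \<beta>]) auto
next
  case True
  then have "\<phi> x = 0" for x
    by blast
  then show thesis
    by (rule that(2))
qed

lemma test_function_outside:
  assumes "\<phi> \<in> test_functions L" "x \<notin> {-L<..<L}"
  shows "\<phi> x = 0"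
proof -
  have "closure {x. \<phi> x \<noteq> 0} \<subseteq> {-L<..<L}"
    using assms(1) by (simp add: test_functions_def)
  then show ?thesis
    using closure_subset[of "{x. \<phi> x \<noteq> 0}"] assms(2) by auto
qed

lemma test_function_bounded:
  assumes "\<phi> \<in> test_functions L"
  obtains B where "\<And>x. \<bar>\<phi> x\<bar> \<le> B"
proof -
  have "compact (\<phi> ` {-L..L})"
    by (intro compact_continuous_image test_function_continuous[OF assms]) simp
  then have "bounded (\<phi> ` {-L..L})"
    by (rule compact_imp_bounded)
  then obtain B where "\<forall>y\<in>\<phi> ` {-L..L}. norm y \<le> B"
    unfolding bounded_iff by blast
  then have B: "\<And>x. x \<in> {-L..L} \<Longrightarrow> \<bar>\<phi> x\<bar> \<le> B"
    by simp
  have "\<bar>\<phi> x\<bar> \<le> max 0 B" for x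
    using B[of x] test_function_outside[OF assms, of x] by (cases "x \<in> {-L<..<L}") auto
  then show thesis
    using that by blast
qed

lemma test_function_measurable:
  "\<phi> \<in> test_functions L \<Longrightarrow> \<phi> \<in> borel_measurable (leb L)"
  by (intro borel_measurable_leb_continuous test_function_continuous)

lemma integrable_mult_test_function:
  assumes "\<phi> \<in> test_functions L" "integrable (leb L) f"
  shows "integrable (leb L) (\<lambda>x. f x * \<phi> x)"
proof -
  obtain B where "\<And>x. \<bar>\<phi> x\<bar> \<le> B"
    using test_function_bounded[OF assms(1)] by blast
  then show ?thesis
    by (intro integrable_mult_bounded[OF assms(2) test_function_measurable[OF assms(1)]])
qed

lemma integrable_test_function:
  assumes "\<phi> \<in> test_functions L"
  shows "integrable (leb L) \<phi>"
  using integrable_mult_test_function[OF assms finite_measure.integrable_const[OF finite_measure_leb, of L 1]]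
  by simp

lemma deriv_test_function:
  assumes "\<phi> \<in> test_functions L"
  shows "deriv \<phi> \<in> test_functions L"
proof -
  let ?K = "closure {x. \<phi> x \<noteq> 0}"
  have K: "compact ?K" "?K \<subseteq> {-L<..<L}"
    using assms by (auto simp: test_functions_def)
  have d: "(deriv ^^ k) (deriv \<phi>) differentiable (at x)" for k x
  proof -
    have "(deriv ^^ Suc k) \<phi> differentiable (at x)"
      using assms unfolding test_functions_def by blast
    then show ?thesis
      by (simp only: funpow_Suc_right o_def)
  qed
  have "deriv \<phi> x = 0" if "x \<notin> ?K" for x
  proof -
    have "\<forall>\<^sub>F y in nhds x. y \<in> - ?K"
      using that by (intro eventually_nhds_in_open) auto
    then have "\<forall>\<^sub>F y in nhds x. \<phi> y = 0"
      by (rule eventually_mono) (use closure_subset[of "{x. \<phi> x \<noteq> 0}"] in blast)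
    then have "(\<phi> has_real_derivative 0) (at x)"
      by (simp only: DERIV_cong_ev[OF refl _ refl] DERIV_const)
    then show ?thesis
      by (rule DERIV_imp_deriv)
  qed
  then have sub: "closure {x. deriv \<phi> x \<noteq> 0} \<subseteq> ?K"
    by (intro closure_minimal) auto
  then have "compact (closure {x. deriv \<phi> x \<noteq> 0})"
    using bounded_subset[OF compact_imp_bounded[OF K(1)] sub] by (simp add: compact_eq_bounded_closed)
  then show ?thesis
    using d sub K(2) unfolding test_functions_def by blast
qed

text \<open>Used to correct a test function by a multiple of a fixed bump so that its mean vanishes.
  Smoothness follows because the class of all such combinations is closed under
  differentiation.\<close>

lemma test_function_diff_scaled:
  assumes \<phi>: "\<phi> \<in> test_functions L" and \<psi>: "\<psi> \<in> test_functions L"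
  shows "(\<lambda>x. \<phi> x - c * \<psi> x) \<in> test_functions L"
proof -
  let ?S = "{(\<lambda>x. f x - c * g x) | f g. f \<in> test_functions L \<and> g \<in> test_functions L}"
  let ?K = "closure {x. \<phi> x \<noteq> 0} \<union> closure {x. \<psi> x \<noteq> 0}"
  have "\<exists>h'\<in>?S. \<forall>x. (h has_real_derivative h' x) (at x)" if h: "h \<in> ?S" for h
  proof -
    obtain f g where fg: "h = (\<lambda>x. f x - c * g x)" "f \<in> test_functions L" "g \<in> test_functions L"
      using h by blast
    have "\<forall>x. (h has_real_derivative deriv f x - c * deriv g x) (at x)"
      unfolding fg(1) by (intro allI DERIV_diff DERIV_cmult test_function_DERIV[of _ L] fg)
    then show ?thesis
      using fg deriv_test_function by (intro bexI[of _ "\<lambda>x. deriv f x - c * deriv g x"]) blast+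
  qed
  moreover have "(\<lambda>x. \<phi> x - c * \<psi> x) \<in> ?S"
    using assms by blast
  ultimately have d: "(deriv ^^ k) (\<lambda>x. \<phi> x - c * \<psi> x) differentiable (at x)" for k x
    by (rule higher_deriv_differentiable)
  have K: "compact ?K" "?K \<subseteq> {-L<..<L}"
    using assms by (auto simp: test_functions_def intro: compact_Un)
  have sub: "closure {x. \<phi> x - c * \<psi> x \<noteq> 0} \<subseteq> ?K"
  proof (rule closure_minimal)
    show "{x. \<phi> x - c * \<psi> x \<noteq> 0} \<subseteq> ?K"
      using closure_subset[of "{x. \<phi> x \<noteq> 0}"] closure_subset[of "{x. \<psi> x \<noteq> 0}"] by fastforce
  qed (use K(1) in \<open>simp add: compact_imp_closed\<close>)
  then have "compact (closure {x. \<phi> x - c * \<psi> x \<noteq> 0})"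
    using bounded_subset[OF compact_imp_bounded[OF K(1)] sub] by (simp add: compact_eq_bounded_closed)
  then show ?thesis
    using d sub K(2) unfolding test_functions_def by blast
qed

lemma integral_leb_FTC:
  fixes f F :: "real \<Rightarrow> real"
  assumes "integrable (leb L) f" "-L \<le> \<alpha>" "\<alpha> \<le> \<beta>" "\<beta> \<le> L"
    and "\<And>x. (F has_real_derivative f x) (at x)"
  shows "(LINT x|leb L. indicator {\<alpha><..<\<beta>} x * f x) = F \<beta> - F \<alpha>"
proof -
  have "(f has_integral F \<beta> - F \<alpha>) {\<alpha>..\<beta>}"
    using assms(3,5)
    by (intro fundamental_theorem_of_calculus)
      (auto intro: has_field_derivative_at_within simp flip: has_real_derivative_iff_has_vector_derivative)
  then show ?thesis
    using integral_leb_interval(1)[OF assms(1,2,4)] by (simp add: integral_unique)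
qed

lemma integral_leb_indicator:
  "(LINT x|leb L. indicator {-L<..<L} x * f x) = (LINT x|leb L. f x)" for f :: "real \<Rightarrow> real"
  by (rule Bochner_Integration.integral_cong) auto

text \<open>A primitive of \<theta> is constant near both ends, where \<theta> vanishes. Normalising
  it at \<open>-L\<close> makes the left constant 0, and the vanishing mean then makes the right one
  0 as well, which gives compact support.\<close>

lemma test_function_antiderivative:
  assumes \<theta>: "\<theta> \<in> test_functions L" and "(LINT x|leb L. \<theta> x) = 0" and "L > 0"
  obtains \<phi> where "\<phi> \<in> test_functions L" "deriv \<phi> = \<theta>"
proof -
  \<comment> \<open>Test functions live on the whole real line, so the primitive is needed there and
    not only on the interval.\<close>
  have "\<exists>F. \<forall>x::real. -\<infinity> < ereal x \<longrightarrow> ereal x < \<infinity> \<longrightarrow> (F has_vector_derivative \<theta> x) (at x)"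
    by (rule einterval_antiderivative) (use DERIV_isCont[OF test_function_DERIV[OF \<theta>]] in auto)
  then obtain F where F: "\<And>x. (F has_real_derivative \<theta> x) (at x)"
    by (auto simp: has_real_derivative_iff_has_vector_derivative)
  define \<phi> where "\<phi> x = F x - F (-L)" for x
  have D: "(\<phi> has_real_derivative \<theta> x) (at x)" for x
    unfolding \<phi>_def[abs_def] using DERIV_diff[OF F DERIV_const[of "F (-L)"]] by simp
  have "F L - F (-L) = 0"
    using integral_leb_FTC[OF integrable_test_function[OF \<theta>] _ _ _ F, of "-L" L] assms(2,3)
    by (simp add: integral_leb_indicator)
  then have ends: "\<phi> (-L) = 0" "\<phi> L = 0"
    by (auto simp: \<phi>_def)
  have const: "\<phi> x = \<phi> y" if "x \<le> y" "\<And>z. x < z \<Longrightarrow> z < y \<Longrightarrow> \<theta> z = 0" for x y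
  proof (cases "x = y")
    case False
    then have "\<phi> y = \<phi> x"
      using that D by (intro DERIV_isconst_end) (auto intro!: continuous_at_imp_continuous_on DERIV_isCont[OF D] intro: DERIV_cong[OF D])
    then show ?thesis by simp
  qed simp
  have "deriv \<phi> = \<theta>"
    using D by (auto intro: DERIV_imp_deriv)
  have diff: "(deriv ^^ k) \<phi> differentiable (at x)" for k x
  proof (cases k)
    case 0
    then show ?thesis
      using D real_differentiable_def by auto
  next
    case (Suc m)
    have "(deriv ^^ m) \<theta> differentiable (at x)"
      using \<theta> unfolding test_functions_def by blast
    then show ?thesis
      unfolding Suc by (simp only: funpow_Suc_right o_def \<open>deriv \<phi> = \<theta>\<close>)
  qed
  have "\<exists>\<alpha> \<beta>. -L < \<alpha> \<and> \<alpha> \<le> \<beta> \<and> \<beta> < L \<and> (\<forall>x. x \<notin> {\<alpha>..\<beta>} \<longrightarrow> \<theta> x = 0)"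
  proof (rule test_function_support[OF \<theta>])
    assume "\<And>x. \<theta> x = 0"
    then show ?thesis
      using \<open>L > 0\<close> by (intro exI[of _ 0]) auto
  qed blast
  then obtain \<alpha> \<beta> where ab: "-L < \<alpha>" "\<alpha> \<le> \<beta>" "\<beta> < L" "\<And>x. x \<notin> {\<alpha>..\<beta>} \<Longrightarrow> \<theta> x = 0"
    by blast
  have zero: "\<phi> x = 0" if "x \<notin> {\<alpha>..\<beta>}" for x
  proof -
    have "x < \<alpha> \<or> \<beta> < x"
      using that by auto
    then consider "x \<le> -L" | "-L \<le> x" "x < \<alpha>" | "\<beta> < x" "x \<le> L" | "L \<le> x"
      by linarith
    then show ?thesis
      by cases (use const[of x "-L"] const[of "-L" x] const[of x L] const[of L x] ab ends in auto)
  qed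
  have sub: "closure {x. \<phi> x \<noteq> 0} \<subseteq> {\<alpha>..\<beta>}"
  proof (rule closure_minimal)
    show "{x. \<phi> x \<noteq> 0} \<subseteq> {\<alpha>..\<beta>}"
      using zero by blast
  qed simp
  then have "compact (closure {x. \<phi> x \<noteq> 0})"
    using bounded_subset[OF bounded_closed_interval] compact_eq_bounded_closed by blast
  moreover have "{\<alpha>..\<beta>} \<subseteq> {-L<..<L}"
    using ab by auto
  ultimately have "\<phi> \<in> test_functions L"
    using diff sub unfolding test_functions_def by blast
  then show thesis
    using that \<open>deriv \<phi> = \<theta>\<close> by blast
qed

section \<open>Uniqueness of weak derivatives\<close>

lemma AE_leb_iff: "(AE x in leb L. P x) \<longleftrightarrow> (AE x in lebesgue. -L < x \<and> x < L \<longrightarrow> P x)"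
  by (subst AE_restrict_space_iff) auto

text \<open>
  Testing against plateaus shows that the integral over every interval vanishes; conclude by Lebesgue
  differentiation.
\<close>

lemma fundamental_lemma:
  fixes h :: "real \<Rightarrow> real"
  assumes h: "integrable (leb L) h"
    and 0: "\<And>\<phi>. \<phi> \<in> test_functions L \<Longrightarrow> (LINT x|leb L. h x * \<phi> x) = 0"
  shows "AE x in leb L. h x = 0"
proof -
  have interval: "integral {\<alpha>..\<beta>} h = 0" if ab: "-L < \<alpha>" "\<beta> < L" for \<alpha> \<beta>
  proof -
    \<comment> \<open>Plateaus have values between 0 and 1, hence \<open>\<bar>h x\<bar>\<close>
      dominates; the limit replaces smooth test functions by the indicator of the interval.\<close>
    have "(\<lambda>n. LINT x|leb L. h x * plateau \<alpha> \<beta> n x) \<longlonglongrightarrow> (LINT x|leb L. h x * indicator {\<alpha><..<\<beta>} x)"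
    proof (rule integral_dominated_convergence[where w = "\<lambda>x. \<bar>h x\<bar>"])
      show "(\<lambda>x. h x * indicator {\<alpha><..<\<beta>} x) \<in> borel_measurable (leb L)"
        using h by (intro borel_measurable_times[OF _ measurable_restrict_space1[OF borel_measurable_indicator]]) auto
      show "(\<lambda>x. h x * plateau \<alpha> \<beta> n x) \<in> borel_measurable (leb L)" for n
        using integrable_mult_test_function[OF plateau_test_functions[OF ab] h] by blast
      show "integrable (leb L) (\<lambda>x. \<bar>h x\<bar>)"
        using h by simp
      show "AE x in leb L. (\<lambda>n. h x * plateau \<alpha> \<beta> n x) \<longlonglongrightarrow> h x * indicator {\<alpha><..<\<beta>} x"
        by (intro AE_I2 tendsto_mult tendsto_const plateau_tendsto)
      show "AE x in leb L. norm (h x * plateau \<alpha> \<beta> n x) \<le> \<bar>h x\<bar>" for n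
        using plateau_bounds[of \<alpha> \<beta> n] by (intro AE_I2) (simp add: abs_mult mult_left_le)
    qed
    then have "(LINT x|leb L. h x * indicator {\<alpha><..<\<beta>} x) = 0"
      using 0[OF plateau_test_functions[OF ab]] by (simp add: LIMSEQ_const_iff)
    then show ?thesis
      using integral_leb_interval(1)[OF h, of \<alpha> \<beta>] ab by (simp add: mult.commute)
  qed
  \<comment> \<open>Extension by zero, since the differentiation theorem asks for integrability on
    every bounded box.\<close>
  define g where "g x = (if x \<in> {-L<..<L} then h x else 0)" for x
  have "integrable lebesgue g"
    unfolding g_def using h by (subst Lebesgue_Measure.integrable_restrict_UNIV) auto
  then have "g integrable_on cbox a b" for a b
    by (intro integrable_on_subcbox[OF integrable_on_lebesgue]) auto
  from integrable_ccontinuous_explicit[OF this] obtain N where N: "negligible N"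
    "\<And>x e. x \<notin> N \<Longrightarrow> 0 < e \<Longrightarrow>
      \<exists>d>0. \<forall>h. 0 < h \<and> h < d \<longrightarrow> norm (integral (cbox x (x + h *\<^sub>R One)) g /\<^sub>R h ^ DIM(real) - g x) < e"
    by blast
  have "h x = 0" if x: "x \<notin> N" "-L < x" "x < L" for x
  proof (rule ccontr)
    assume "h x \<noteq> 0"
    \<comment> \<open>The tolerance is chosen as \<open>\<bar>h x\<bar>\<close> itself: averages
      over short intervals to the right of \<open>x\<close> are 0, so their distance to
      \<open>h x\<close> is exactly \<open>\<bar>h x\<bar>\<close> and cannot be smaller.\<close>
    then obtain d where d: "d > 0"
      "\<And>r. 0 < r \<Longrightarrow> r < d \<Longrightarrow> norm (integral (cbox x (x + r *\<^sub>R One)) g /\<^sub>R r ^ DIM(real) - g x) < \<bar>h x\<bar>"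
      using N(2)[OF x(1), of "\<bar>h x\<bar>"] by auto
    \<comment> \<open>Halving makes \<open>r\<close> strictly smaller than \<open>d\<close> and
      keeps \<open>x + r\<close> strictly inside the interval.\<close>
    define r where "r = min d (L - x) / 2"
    have r: "0 < r" "r < d" "x + r < L"
      using d(1) x(3) by (auto simp: r_def min_def field_simps)
    have "integral {x..x + r} g = integral {x..x + r} h"
      by (rule integral_cong) (use x r in \<open>auto simp: g_def\<close>)
    also have "\<dots> = 0"
      using x r by (intro interval) auto
    finally show False
      using d(2)[OF r(1,2)] x by (simp add: g_def)
  qed
  moreover have "AE x in lebesgue. x \<notin> N"
    using N(1) AE_not_in negligible_iff_null_sets by blast
  ultimately show ?thesis
    unfolding AE_leb_iff by (auto elim!: eventually_mono)
qed

lemma integrable_eqI_test_functions: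
  fixes v w :: "real \<Rightarrow> real"
  assumes v: "integrable (leb L) v" and w: "integrable (leb L) w"
    and eq: "\<And>\<phi>. \<phi> \<in> test_functions L \<Longrightarrow> (LINT x|leb L. v x * \<phi> x) = (LINT x|leb L. w x * \<phi> x)"
  shows "AE x in leb L. v x = w x"
proof -
  have "AE x in leb L. v x - w x = 0"
  proof (rule fundamental_lemma)
    fix \<phi> assume \<phi>: "\<phi> \<in> test_functions L"
    show "(LINT x|leb L. (v x - w x) * \<phi> x) = 0"
      using integrable_mult_test_function[OF \<phi> v] integrable_mult_test_function[OF \<phi> w] eq[OF \<phi>]
      by (simp add: left_diff_distrib)
  qed (use v w in auto)
  then show ?thesis
    by simp
qed

lemma is_weak_deriv_unique:
  assumes "is_weak_deriv L j v w" "is_weak_deriv L j v w'" "w \<in> L2 L" "w' \<in> L2 L"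
  shows "AE x in leb L. w x = w' x"
proof (rule integrable_eqI_test_functions)
  fix \<phi> assume "\<phi> \<in> test_functions L"
  then have "(-1) ^ j * (LINT x|leb L. w x * \<phi> x) = (-1) ^ j * (LINT x|leb L. w' x * \<phi> x)"
    using assms(1,2) unfolding is_weak_deriv_def by (metis (no_types))
  then show "(LINT x|leb L. w x * \<phi> x) = (LINT x|leb L. w' x * \<phi> x)"
    by simp
qed (use assms integrable_L2 in auto)

text \<open>For an arbitrary test function \<psi>, subtracting a multiple of a fixed bump
  \<open>\<psi>0\<close> leaves a function of mean zero, which is the derivative of a test function
  and hence orthogonal to \<open>h\<close>. This says that \<open>h\<close> and a constant have the
  same integral against \<psi>; the constant is the mean of \<open>h\<close> weighted by
  \<open>\<psi>0\<close>.\<close>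

lemma du_Bois_Reymond:
  fixes h :: "real \<Rightarrow> real"
  assumes h: "integrable (leb L) h" and "L > 0"
    and 0: "\<And>\<phi>. \<phi> \<in> test_functions L \<Longrightarrow> (LINT x|leb L. h x * deriv \<phi> x) = 0"
  obtains c where "AE x in leb L. h x = c"
proof -
  define \<psi>0 where "\<psi>0 = plateau (-L/2) (L/2) 0"
  have \<psi>0: "\<psi>0 \<in> test_functions L"
    unfolding \<psi>0_def using \<open>L > 0\<close> by (intro plateau_test_functions) auto
  define m where "m = (LINT x|leb L. \<psi>0 x)"
  \<comment> \<open>A vanishing integral would force the nonnegative bump to vanish almost
    everywhere, although it is positive on an interval of positive measure.\<close>
  have "m \<noteq> 0"
  proof
    assume "m = 0"
    then have "AE x in leb L. \<psi>0 x = 0"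
      using integral_nonneg_eq_0_iff_AE[OF integrable_test_function[OF \<psi>0]] plateau_bounds(1)
      by (simp add: m_def \<psi>0_def)
    then have "AE x in lebesgue. x \<notin> {-L/2<..<L/2}"
      unfolding AE_leb_iff
    proof (rule eventually_mono)
      fix x assume "-L < x \<and> x < L \<longrightarrow> \<psi>0 x = 0"
      then show "x \<notin> {-L/2<..<L/2}"
        using plateau_pos[of x "-L/2" "L/2" 0] by (auto simp: \<psi>0_def)
    qed
    then have "{-L/2<..<L/2} \<in> null_sets lebesgue"
      by (subst AE_iff_null_sets) auto
    then show False
      using \<open>L > 0\<close> by (simp add: null_sets_def)
  qed
  define c where "c = (LINT x|leb L. h x * \<psi>0 x) / m"
  have const: "integrable (leb L) (\<lambda>x. c)"
    by (rule finite_measure.integrable_const[OF finite_measure_leb])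
  have "AE x in leb L. h x = c"
  proof (rule integrable_eqI_test_functions[OF h const])
    fix \<psi> assume \<psi>: "\<psi> \<in> test_functions L"
    define k where "k = (LINT x|leb L. \<psi> x) / m"
    have \<theta>: "(\<lambda>x. \<psi> x - k * \<psi>0 x) \<in> test_functions L"
      by (rule test_function_diff_scaled[OF \<psi> \<psi>0])
    have "(LINT x|leb L. \<psi> x - k * \<psi>0 x) = 0"
      using integrable_test_function[OF \<psi>] integrable_test_function[OF \<psi>0] \<open>m \<noteq> 0\<close>
      by (simp add: k_def flip: m_def)
    from test_function_antiderivative[OF \<theta> this \<open>L > 0\<close>]
    obtain \<phi> where \<phi>: "\<phi> \<in> test_functions L" "deriv \<phi> = (\<lambda>x. \<psi> x - k * \<psi>0 x)" .
    have "0 = (LINT x|leb L. h x * (\<psi> x - k * \<psi>0 x))"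
      using 0[OF \<phi>(1)] \<phi>(2) by simp
    also have "\<dots> = (LINT x|leb L. h x * \<psi> x - k * (h x * \<psi>0 x))"
      by (simp add: algebra_simps)
    also have "\<dots> = (LINT x|leb L. h x * \<psi> x) - k * (LINT x|leb L. h x * \<psi>0 x)"
      using integrable_mult_test_function[OF \<psi> h] integrable_mult_test_function[OF \<psi>0 h] by simp
    finally show "(LINT x|leb L. h x * \<psi> x) = (LINT x|leb L. c * \<psi> x)"
      using \<open>m \<noteq> 0\<close> by (simp add: k_def c_def)
  qed
  then show thesis
    using that by blast
qed

section \<open>Continuous representatives\<close>

text \<open>Integration by parts when \<open>w\<close> is merely integrable: the left side is a
  double integral over \<xi> < x, and after exchanging the order of integration the inner integral
  of the derivative is \<open>\<phi> L - \<phi> \<xi>\<close>, whose first term is 0.\<close>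

lemma integral_primitive_mult_deriv:
  fixes w :: "real \<Rightarrow> real"
  assumes w: "integrable (leb L) w" and \<phi>: "\<phi> \<in> test_functions L"
  shows "(LINT x|leb L. integral {-L..x} w * deriv \<phi> x) = - (LINT x|leb L. w x * \<phi> x)"
proof -
  interpret finite_measure "leb L" by (rule finite_measure_leb)
  interpret pair_sigma_finite "leb L" "leb L" ..
  define f where "f \<xi> x = indicator {..<x} \<xi> * w \<xi> * deriv \<phi> x" for \<xi> x
  have \<phi>': "deriv \<phi> \<in> test_functions L"
    by (rule deriv_test_function[OF \<phi>])
  obtain B where B: "\<And>x. \<bar>deriv \<phi> x\<bar> \<le> B"
    using test_function_bounded[OF \<phi>'] by blast
  have [measurable]: "w \<in> borel_measurable (leb L)" "deriv \<phi> \<in> borel_measurable (leb L)"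
    using w test_function_measurable[OF \<phi>'] by auto
  have [measurable]: "(\<lambda>x. x) \<in> borel_measurable (leb L)"
    by (rule borel_measurable_leb_continuous) simp
  have meas: "case_prod f \<in> borel_measurable (leb L \<Otimes>\<^sub>M leb L)"
  proof -
    have "case_prod f = (\<lambda>p. (if fst p < snd p then 1 else 0) * w (fst p) * deriv \<phi> (snd p))"
      by (auto simp: f_def indicator_def fun_eq_iff)
    also have "\<dots> \<in> borel_measurable (leb L \<Otimes>\<^sub>M leb L)"
      by measurable
    finally show ?thesis .
  qed
  \<comment> \<open>The majorant for Fubini's theorem depends on one variable only and is integrable
    over the product because the interval has finite measure.\<close>
  have "integrable (leb L \<Otimes>\<^sub>M leb L) (\<lambda>p. w (fst p) * B)"
  proof (rule Fubini_integrable)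
    show "integrable (leb L) (\<lambda>x. LINT y|leb L. norm (w (fst (x, y)) * B))"
      using w by (simp add: abs_mult)
    show "AE x in leb L. integrable (leb L) (\<lambda>y. w (fst (x, y)) * B)"
      by simp
  qed measurable
  then have int: "integrable (leb L \<Otimes>\<^sub>M leb L) (case_prod f)"
  proof (rule Bochner_Integration.integrable_bound[OF _ meas])
    have "\<bar>f \<xi> x\<bar> \<le> \<bar>w \<xi> * B\<bar>" for \<xi> x
    proof -
      have "\<bar>f \<xi> x\<bar> \<le> \<bar>w \<xi>\<bar> * \<bar>deriv \<phi> x\<bar>"
        by (auto simp: f_def indicator_def abs_mult)
      also have "\<dots> \<le> \<bar>w \<xi>\<bar> * \<bar>B\<bar>"
        using B[of x] by (intro mult_left_mono) auto
      finally show ?thesis by (simp add: abs_mult)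
    qed
    then show "AE p in leb L \<Otimes>\<^sub>M leb L. norm (case_prod f p) \<le> norm (w (fst p) * B)"
      by (auto intro!: AE_I2)
  qed
  have "(LINT x|leb L. integral {-L..x} w * deriv \<phi> x) = (LINT x|leb L. (LINT \<xi>|leb L. f \<xi> x))"
  proof (rule Bochner_Integration.integral_cong)
    fix x assume "x \<in> space (leb L)"
    then have x: "-L < x" "x < L" by auto
    have "(LINT \<xi>|leb L. f \<xi> x) = (LINT \<xi>|leb L. indicator {-L<..<x} \<xi> * w \<xi>) * deriv \<phi> x"
      unfolding f_def integral_mult_left_zero[symmetric]
      by (intro Bochner_Integration.integral_cong) (auto simp: indicator_def)
    then show "integral {-L..x} w * deriv \<phi> x = (LINT \<xi>|leb L. f \<xi> x)"
      using integral_leb_interval(1)[OF w, of "-L" x] x by simp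
  qed simp
  also have "\<dots> = (LINT \<xi>|leb L. (LINT x|leb L. f \<xi> x))"
    by (rule Fubini_integral[OF int])
  also have "\<dots> = (LINT \<xi>|leb L. - (w \<xi> * \<phi> \<xi>))"
  proof (rule Bochner_Integration.integral_cong)
    fix \<xi> assume "\<xi> \<in> space (leb L)"
    then have \<xi>: "-L < \<xi>" "\<xi> < L" by auto
    have "(LINT x|leb L. f \<xi> x) = w \<xi> * (LINT x|leb L. indicator {\<xi><..<L} x * deriv \<phi> x)"
      unfolding f_def integral_mult_right_zero[symmetric]
      by (intro Bochner_Integration.integral_cong) (auto simp: indicator_def)
    also have "(LINT x|leb L. indicator {\<xi><..<L} x * deriv \<phi> x) = \<phi> L - \<phi> \<xi>"
      using \<xi> by (intro integral_leb_FTC integrable_test_function[OF \<phi>'] test_function_DERIV[OF \<phi>]) auto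
    finally show "(LINT x|leb L. f \<xi> x) = - (w \<xi> * \<phi> \<xi>)"
      using test_function_outside[OF \<phi>, of L] by simp
  qed simp
  finally show ?thesis
    by simp
qed

lemma continuous_on_primitive:
  fixes w :: "real \<Rightarrow> real"
  assumes "integrable (leb L) w"
  shows "continuous_on {-L..L} (\<lambda>x. integral {-L..x} w)"
  using integral_leb_interval(2)[OF assms, of "-L" L]
  by (intro indefinite_integral_continuous_1) (simp add: absolutely_integrable_on_def)

lemma continuous_bounded:
  fixes f :: "real \<Rightarrow> real"
  assumes "continuous_on {a..b} f"
  obtains B where "\<And>x. x \<in> {a..b} \<Longrightarrow> \<bar>f x\<bar> \<le> B"
proof -
  have "bounded (f ` {a..b})"
    by (intro compact_imp_bounded compact_continuous_image assms) simp
  then obtain B where "\<forall>y\<in>f ` {a..b}. norm y \<le> B"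
    unfolding bounded_iff by blast
  then show thesis
    by (intro that[of B]) auto
qed

lemma integrable_leb_continuous:
  fixes f :: "real \<Rightarrow> real"
  assumes "continuous_on {-L..L} f"
  shows "integrable (leb L) f"
proof -
  obtain B where "\<And>x. x \<in> {-L..L} \<Longrightarrow> \<bar>f x\<bar> \<le> B"
    using continuous_bounded[OF assms] by blast
  then show ?thesis
    using borel_measurable_leb_continuous[OF assms]
    by (intro finite_measure.integrable_const_bound[OF finite_measure_leb, where B = B] AE_I2) auto
qed

text \<open>Subtracting the primitive of \<open>w\<close> from \<open>v\<close> leaves a function
  that is orthogonal to the derivatives of all test functions, hence constant almost
  everywhere.\<close>

lemma weak_deriv_primitive:
  fixes v w :: "real \<Rightarrow> real"
  assumes "L > 0" and v: "integrable (leb L) v" and w: "integrable (leb L) w"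
    and wd: "is_weak_deriv L 1 v w"
  obtains c where "AE x in leb L. v x = c + integral {-L..x} w"
proof -
  let ?P = "\<lambda>x. integral {-L..x} w"
  have P: "integrable (leb L) ?P"
    by (intro integrable_leb_continuous continuous_on_primitive w)
  have "(LINT x|leb L. (v x - ?P x) * deriv \<phi> x) = 0" if \<phi>: "\<phi> \<in> test_functions L" for \<phi>
  proof -
    note \<phi>' = deriv_test_function[OF \<phi>]
    have "(LINT x|leb L. (v x - ?P x) * deriv \<phi> x)
        = (LINT x|leb L. v x * deriv \<phi> x) - (LINT x|leb L. ?P x * deriv \<phi> x)"
      using integrable_mult_test_function[OF \<phi>' v] integrable_mult_test_function[OF \<phi>' P]
      by (simp add: left_diff_distrib)
    also have "\<dots> = 0"
      using wd \<phi> integral_primitive_mult_deriv[OF w \<phi>] by (simp add: is_weak_deriv_def)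
    finally show ?thesis .
  qed
  from du_Bois_Reymond[OF Bochner_Integration.integrable_diff[OF v P] \<open>L > 0\<close> this]
  obtain c where "AE x in leb L. v x - ?P x = c" .
  then have "AE x in leb L. v x = c + ?P x"
    by (rule AE_mp) (rule AE_I2, simp)
  then show thesis
    by (rule that)
qed

text \<open>The ends of the interval form a null set, so \<open>\<bar>f x - g x\<bar>\<close> has
  integral 0 over the closed interval and, being continuous and nonnegative, vanishes there
  everywhere. This fixes the values of \<open>cont_rep\<close> up to and including the
  boundary.\<close>

lemma continuous_AE_eq_imp_eq:
  fixes f g :: "real \<Rightarrow> real"
  assumes "L > 0" "continuous_on {-L..L} f" "continuous_on {-L..L} g"
    and "AE x in leb L. f x = g x" and "x \<in> {-L..L}"
  shows "f x = g x"
proof -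
  have "AE x in lebesgue. x \<noteq> -L \<and> x \<noteq> L"
    using AE_completion[OF AE_lborel_singleton[of "-L"]] AE_completion[OF AE_lborel_singleton[of L]] by auto
  then have "AE x in lebesgue_on {-L..L}. \<bar>f x - g x\<bar> = 0"
    using assms(4) unfolding AE_leb_iff by (subst AE_restrict_space_iff) auto
  then have "integral\<^sup>L (lebesgue_on {-L..L}) (\<lambda>x. \<bar>f x - g x\<bar>) = 0"
    by (rule integral_eq_zero_AE)
  then have "\<forall>x\<in>{-L..L}. \<bar>f x - g x\<bar> = 0"
    using assms(1-3) by (subst (asm) integralL_eq_0_iff) (auto intro!: continuous_intros)
  then show ?thesis
    using assms(5) by auto
qed

section \<open>Calculus of weak derivatives and Sobolev norms\<close>

lemma weak_deriv_spec:
  assumes "v \<in> sobolev s L" "j \<le> s"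
  shows "weak_deriv L j v \<in> L2 L" "is_weak_deriv L j v (weak_deriv L j v)"
proof -
  have "\<exists>w. w \<in> L2 L \<and> is_weak_deriv L j v w"
    using assms unfolding sobolev_def by blast
  from someI_ex[OF this] show "weak_deriv L j v \<in> L2 L" "is_weak_deriv L j v (weak_deriv L j v)"
    unfolding weak_deriv_def by auto
qed

lemma sobolev_mono: "s \<le> r \<Longrightarrow> sobolev r L \<subseteq> sobolev s L"
  unfolding sobolev_def by (auto intro: order_trans)

lemma sobolev_L2: "v \<in> sobolev s L \<Longrightarrow> v \<in> L2 L"
  by (simp add: sobolev_def)

lemma L2_diff:
  assumes "v \<in> L2 L" "w \<in> L2 L"
  shows "(\<lambda>x. v x - w x) \<in> L2 L"
proof -
  have [measurable]: "v \<in> borel_measurable (leb L)" "w \<in> borel_measurable (leb L)"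
    using assms by (auto simp: L2_def)
  have "integrable (leb L) (\<lambda>x. 2 * (v x)\<^sup>2 + 2 * (w x)\<^sup>2)"
    using assms by (auto simp: L2_def)
  then have "integrable (leb L) (\<lambda>x. (v x - w x)\<^sup>2)"
  proof (rule Bochner_Integration.integrable_bound)
    have "(a - b)\<^sup>2 \<le> 2 * a\<^sup>2 + 2 * b\<^sup>2" for a b :: real
      using zero_le_power2[of "a + b"] by (simp add: power2_sum power2_diff)
    then show "AE x in leb L. norm ((v x - w x)\<^sup>2) \<le> norm (2 * (v x)\<^sup>2 + 2 * (w x)\<^sup>2)"
      by (auto intro!: AE_I2)
  qed measurable
  then show ?thesis
    by (simp add: L2_def)
qed

lemma higher_deriv_test_function: "\<phi> \<in> test_functions L \<Longrightarrow> (deriv ^^ j) \<phi> \<in> test_functions L"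
  by (induction j) (auto intro: deriv_test_function)

lemma is_weak_deriv_diff:
  assumes "v \<in> L2 L" "v' \<in> L2 L" "w \<in> L2 L" "w' \<in> L2 L"
    and "is_weak_deriv L j v w" "is_weak_deriv L j v' w'"
  shows "is_weak_deriv L j (\<lambda>x. v x - v' x) (\<lambda>x. w x - w' x)"
  unfolding is_weak_deriv_def
proof
  fix \<phi> assume \<phi>: "\<phi> \<in> test_functions L"
  note i = integrable_mult_test_function[OF higher_deriv_test_function[OF \<phi>, of j] integrable_L2]
    integrable_mult_test_function[OF \<phi> integrable_L2]
  show "(LINT x|leb L. (v x - v' x) * (deriv ^^ j) \<phi> x) = (-1) ^ j * (LINT x|leb L. (w x - w' x) * \<phi> x)"
    using assms(5,6) \<phi> i(1)[OF assms(1)] i(1)[OF assms(2)] i(2)[OF assms(3)] i(2)[OF assms(4)]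
    by (simp add: is_weak_deriv_def left_diff_distrib right_diff_distrib)
qed

lemma sobolev_diff:
  assumes "v \<in> sobolev s L" "w \<in> sobolev s L"
  shows "(\<lambda>x. v x - w x) \<in> sobolev s L"
  unfolding sobolev_def
proof (intro CollectI conjI allI impI)
  show "(\<lambda>x. v x - w x) \<in> L2 L"
    using assms by (intro L2_diff sobolev_L2)
  fix j assume "j \<le> s"
  note wd = weak_deriv_spec[OF assms(1) this] weak_deriv_spec[OF assms(2) this]
  show "\<exists>u\<in>L2 L. is_weak_deriv L j (\<lambda>x. v x - w x) u"
  proof (rule bexI)
    show "is_weak_deriv L j (\<lambda>x. v x - w x) (\<lambda>x. weak_deriv L j v x - weak_deriv L j w x)"
      by (intro is_weak_deriv_diff wd sobolev_L2[OF assms(1)] sobolev_L2[OF assms(2)])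
  qed (intro L2_diff wd)
qed

text \<open>The derivatives on the two sides are chosen independently, so linearity can hold only up
  to null sets and rests on \<open>is_weak_deriv_unique\<close>.\<close>

lemma weak_deriv_diff:
  assumes "v \<in> sobolev s L" "w \<in> sobolev s L" "j \<le> s"
  shows "AE x in leb L. weak_deriv L j (\<lambda>x. v x - w x) x = weak_deriv L j v x - weak_deriv L j w x"
proof -
  note wd = weak_deriv_spec[OF assms(1,3)] weak_deriv_spec[OF assms(2,3)]
  note d = weak_deriv_spec[OF sobolev_diff[OF assms(1,2)] assms(3)]
  show ?thesis
    by (rule is_weak_deriv_unique[OF d(2) _ d(1)])
      (intro is_weak_deriv_diff L2_diff wd sobolev_L2[OF assms(1)] sobolev_L2[OF assms(2)])+
qed

text \<open>The summand of order 0 in the Sobolev norm is formed with a chosen function as well;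
  this identifies it with \<open>v\<close>.\<close>

lemma weak_deriv_0:
  assumes "v \<in> sobolev s L"
  shows "AE x in leb L. weak_deriv L 0 v x = v x"
  using weak_deriv_spec[OF assms, of 0] sobolev_L2[OF assms]
  by (intro is_weak_deriv_unique[of L 0 v]) (auto simp: is_weak_deriv_def)

lemma L2_norm_cong_AE:
  assumes "v \<in> L2 L" "w \<in> L2 L" "AE x in leb L. v x = w x"
  shows "L2_norm L v = L2_norm L w"
proof -
  have "(LINT x|leb L. (v x)\<^sup>2) = (LINT x|leb L. (w x)\<^sup>2)"
    using assms by (intro integral_cong_AE) (auto simp: L2_def)
  then show ?thesis
    by (simp add: L2_norm_def)
qed

lemma L2_norm_weak_deriv_le:
  assumes "j \<le> s"
  shows "L2_norm L (weak_deriv L j v) \<le> sobolev_norm s L v"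
  unfolding sobolev_norm_def
proof (rule real_le_rsqrt)
  show "(L2_norm L (weak_deriv L j v))\<^sup>2 \<le> (\<Sum>j\<le>s. (L2_norm L (weak_deriv L j v))\<^sup>2)"
    using assms by (intro member_le_sum) auto
qed

lemma L2_norm_le:
  assumes "v \<in> sobolev s L"
  shows "L2_norm L v \<le> sobolev_norm s L v"
proof -
  have "L2_norm L (weak_deriv L 0 v) = L2_norm L v"
    using weak_deriv_spec(1)[OF assms, of 0] sobolev_L2[OF assms] weak_deriv_0[OF assms]
    by (intro L2_norm_cong_AE) auto
  then show ?thesis
    using L2_norm_weak_deriv_le[of 0 s L v] by simp
qed

section \<open>Embedding of the first order Sobolev space into the continuous functions\<close>

lemma measure_leb: "L > 0 \<Longrightarrow> measure (leb L) {-L<..<L} = 2 * L"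
  by (simp add: measure_restrict_space)

text \<open>The Cauchy-Schwarz inequality against the constant 1, read off from the nonnegative
  variance of \<open>\<bar>v x\<bar>\<close>; \<open>m\<close> is its mean over the interval of
  length \<open>2 * L\<close>.\<close>

lemma integral_abs_le_L2_norm:
  assumes "L > 0" and v: "v \<in> L2 L"
  shows "(LINT x|leb L. \<bar>v x\<bar>) \<le> sqrt (2 * L) * L2_norm L v"
proof -
  interpret finite_measure "leb L" by (rule finite_measure_leb)
  define J where "J = (LINT x|leb L. \<bar>v x\<bar>)"
  define m where "m = J / (2 * L)"
  have i: "integrable (leb L) (\<lambda>x. \<bar>v x\<bar>)" "integrable (leb L) (\<lambda>x. (v x)\<^sup>2)"
    using integrable_L2[OF v] v by (auto simp: L2_def)
  have "0 \<le> (LINT x|leb L. (\<bar>v x\<bar> - m)\<^sup>2)"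
    by simp
  also have "(\<lambda>x. (\<bar>v x\<bar> - m)\<^sup>2) = (\<lambda>x. (v x)\<^sup>2 - (2 * m * \<bar>v x\<bar> - m\<^sup>2))"
    by (auto simp: power2_diff)
  also have "(LINT x|leb L. (v x)\<^sup>2 - (2 * m * \<bar>v x\<bar> - m\<^sup>2)) = (LINT x|leb L. (v x)\<^sup>2) - (2 * m * J - 2 * L * m\<^sup>2)"
    using i measure_leb[OF \<open>L > 0\<close>] by (simp add: J_def)
  also have "\<dots> = (LINT x|leb L. (v x)\<^sup>2) - J\<^sup>2 / (2 * L)"
    using \<open>L > 0\<close> by (simp add: m_def field_simps power2_eq_square)
  finally have "J\<^sup>2 \<le> 2 * L * (LINT x|leb L. (v x)\<^sup>2)"
    using \<open>L > 0\<close> by (simp add: field_simps)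
  then have "J \<le> sqrt (2 * L * (LINT x|leb L. (v x)\<^sup>2))"
    by (rule real_le_rsqrt)
  then show ?thesis
    by (simp add: J_def L2_norm_def real_sqrt_mult)
qed

lemma sobolev_1_primitive:
  assumes "L > 0" and v: "v \<in> sobolev 1 L"
  obtains c where "AE x in leb L. v x = c + integral {-L..x} (weak_deriv L 1 v)"
    and "continuous_on {-L..L} (\<lambda>x. c + integral {-L..x} (weak_deriv L 1 v))"
proof -
  note wd = weak_deriv_spec[OF v order_refl]
  obtain c where "AE x in leb L. v x = c + integral {-L..x} (weak_deriv L 1 v)"
    using weak_deriv_primitive[OF \<open>L > 0\<close> integrable_L2[OF sobolev_L2[OF v]] integrable_L2[OF wd(1)] wd(2)] .
  moreover have "continuous_on {-L..L} (\<lambda>x. c + integral {-L..x} (weak_deriv L 1 v))"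
    by (intro continuous_on_add continuous_on_const continuous_on_primitive integrable_L2 wd)
  ultimately show thesis
    by (rule that)
qed

lemma cont_rep_spec:
  assumes "L > 0" and v: "v \<in> sobolev 1 L"
  shows "continuous_on {-L..L} (cont_rep L v)" "AE x in leb L. cont_rep L v x = v x"
proof -
  obtain c where c: "AE x in leb L. v x = c + integral {-L..x} (weak_deriv L 1 v)"
    "continuous_on {-L..L} (\<lambda>x. c + integral {-L..x} (weak_deriv L 1 v))"
    using sobolev_1_primitive[OF assms] .
  have "AE x in leb L. c + integral {-L..x} (weak_deriv L 1 v) = v x"
    using c(1) by (rule AE_mp) (rule AE_I2, simp)
  with c(2) have "\<exists>w. continuous_on {-L..L} w \<and> (AE x in leb L. w x = v x)"
    by (intro exI conjI)
  from someI_ex[OF this] show "continuous_on {-L..L} (cont_rep L v)" "AE x in leb L. cont_rep L v x = v x"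
    unfolding cont_rep_def by auto
qed

lemma cont_rep_eqI:
  assumes "L > 0" "v \<in> sobolev 1 L" "continuous_on {-L..L} f" "AE x in leb L. v x = f x" "x \<in> {-L..L}"
  shows "cont_rep L v x = f x"
proof (rule continuous_AE_eq_imp_eq[OF assms(1) _ assms(3) _ assms(5)])
  show "AE x in leb L. cont_rep L v x = f x"
    using cont_rep_spec(2)[OF assms(1,2)] assms(4) by eventually_elim simp
qed (rule cont_rep_spec(1)[OF assms(1,2)])

lemma cont_rep_primitive:
  assumes "L > 0" and v: "v \<in> sobolev 1 L"
  obtains c where "\<And>x. x \<in> {-L..L} \<Longrightarrow> cont_rep L v x = c + integral {-L..x} (weak_deriv L 1 v)"
proof -
  obtain c where c: "AE x in leb L. v x = c + integral {-L..x} (weak_deriv L 1 v)"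
    "continuous_on {-L..L} (\<lambda>x. c + integral {-L..x} (weak_deriv L 1 v))"
    using sobolev_1_primitive[OF assms] .
  from cont_rep_eqI[OF assms c(2,1)] show thesis
    by (rule that)
qed

lemma cont_rep_diff:
  assumes "L > 0" "v \<in> sobolev 1 L" "w \<in> sobolev 1 L" "x \<in> {-L..L}"
  shows "cont_rep L (\<lambda>x. v x - w x) x = cont_rep L v x - cont_rep L w x"
proof (rule cont_rep_eqI[OF assms(1) sobolev_diff[OF assms(2,3)] _ _ assms(4)])
  show "continuous_on {-L..L} (\<lambda>x. cont_rep L v x - cont_rep L w x)"
    by (intro continuous_on_diff cont_rep_spec assms)
  show "AE x in leb L. v x - w x = cont_rep L v x - cont_rep L w x"
    using cont_rep_spec(2)[OF assms(1,2)] cont_rep_spec(2)[OF assms(1,3)] by eventually_elim simp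
qed

text \<open>The oscillation of the representative is at most \<open>J\<close>, the integral of the
  modulus of the derivative, so its modulus at \<open>x\<close> exceeds that at any other point by
  at most \<open>J\<close>. Averaging over the other point leaves the mean of
  \<open>\<bar>v y\<bar>\<close> plus \<open>J\<close>, and Cauchy-Schwarz bounds both.\<close>

lemma cont_rep_bound:
  assumes "L > 0" and v: "v \<in> sobolev 1 L" and x: "x \<in> {-L..L}"
  shows "\<bar>cont_rep L v x\<bar> \<le> sqrt (2 * L) * L2_norm L v / (2 * L) + sqrt (2 * L) * L2_norm L (weak_deriv L 1 v)"
proof -
  interpret finite_measure "leb L" by (rule finite_measure_leb)
  let ?P = "cont_rep L v" and ?w = "weak_deriv L 1 v"
  note wd = weak_deriv_spec[OF v order_refl]
  note w = integrable_L2[OF wd(1)]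
  obtain c where c: "\<And>x. x \<in> {-L..L} \<Longrightarrow> ?P x = c + integral {-L..x} ?w"
    using cont_rep_primitive[OF assms(1,2)] by blast
  define J where "J = (LINT x|leb L. \<bar>?w x\<bar>)"
  have le: "\<bar>?P z - ?P y\<bar> \<le> J" if "-L \<le> y" "y \<le> z" "z \<le> L" for y z
  proof -
    have "?w absolutely_integrable_on {-L..z}"
      using integral_leb_interval(2)[OF w, of "-L" z] that by simp
    then have "integral {-L..y} ?w + integral {y..z} ?w = integral {-L..z} ?w"
      using that by (intro Henstock_Kurzweil_Integration.integral_combine) (auto simp: absolutely_integrable_on_def)
    then have "?P z - ?P y = (LINT x|leb L. indicator {y<..<z} x * ?w x)"
      using c[of y] c[of z] that integral_leb_interval(1)[OF w, of y z] by simp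
    also have "\<bar>\<dots>\<bar> \<le> (LINT x|leb L. \<bar>indicator {y<..<z} x * ?w x\<bar>)"
      by (rule integral_abs_bound)
    also have "\<dots> \<le> J"
      unfolding J_def using w by (intro integral_mono_AE' AE_I2) (auto simp: indicator_def)
    finally show ?thesis .
  qed
  have "\<bar>?P x\<bar> - J \<le> \<bar>?P y\<bar>" if "y \<in> {-L<..<L}" for y
    using le[of x y] le[of y x] that x by (cases "x \<le> y") auto
  moreover have P: "integrable (leb L) (\<lambda>y. \<bar>?P y\<bar>)"
    by (intro Bochner_Integration.integrable_abs integrable_leb_continuous cont_rep_spec assms)
  ultimately have "(LINT y|leb L. \<bar>?P x\<bar> - J) \<le> (LINT y|leb L. \<bar>?P y\<bar>)"
    by (intro integral_mono) auto
  also have "(LINT y|leb L. \<bar>?P x\<bar> - J) = 2 * L * (\<bar>?P x\<bar> - J)"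
    using measure_leb[OF \<open>L > 0\<close>] by simp
  also have "(LINT y|leb L. \<bar>?P y\<bar>) = (LINT y|leb L. \<bar>v y\<bar>)"
  proof (rule integral_cong_AE)
    show "AE x in leb L. \<bar>cont_rep L v x\<bar> = \<bar>v x\<bar>"
      using cont_rep_spec(2)[OF assms(1,2)] by eventually_elim simp
  qed (use P integrable_L2[OF sobolev_L2[OF v]] in auto)
  also have "\<dots> \<le> sqrt (2 * L) * L2_norm L v"
    by (rule integral_abs_le_L2_norm[OF assms(1) sobolev_L2[OF v]])
  finally have "\<bar>?P x\<bar> \<le> sqrt (2 * L) * L2_norm L v / (2 * L) + J"
    using \<open>L > 0\<close> by (simp add: field_simps)
  moreover have "J \<le> sqrt (2 * L) * L2_norm L ?w"
    unfolding J_def by (rule integral_abs_le_L2_norm[OF assms(1) wd(1)])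
  ultimately show ?thesis
    by simp
qed

text \<open>The sum of the two coefficients in \<open>cont_rep_bound\<close>, after both norms there
  are replaced by one larger Sobolev norm.\<close>

definition embedding_const :: "real \<Rightarrow> real" where
  "embedding_const L = sqrt (2 * L) / (2 * L) + sqrt (2 * L)"

lemma cont_rep_le_sobolev_norm:
  assumes "L > 0" "v \<in> sobolev 1 L" "x \<in> {-L..L}"
  shows "\<bar>cont_rep L v x\<bar> \<le> embedding_const L * sobolev_norm 1 L v"
proof -
  have "\<bar>cont_rep L v x\<bar> \<le> sqrt (2 * L) / (2 * L) * L2_norm L v + sqrt (2 * L) * L2_norm L (weak_deriv L 1 v)"
    using cont_rep_bound[OF assms] by simp
  also have "\<dots> \<le> sqrt (2 * L) / (2 * L) * sobolev_norm 1 L v + sqrt (2 * L) * sobolev_norm 1 L v"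
    using \<open>L > 0\<close> by (intro add_mono mult_left_mono L2_norm_le[OF assms(2)] L2_norm_weak_deriv_le) auto
  finally show ?thesis
    by (simp add: embedding_const_def algebra_simps)
qed

section \<open>Pointwise values of the derivative of a second order Sobolev function\<close>

text \<open>The second weak derivative is defined by a single test against the second derivative of
  \<phi>. Since the derivative of \<phi> is again a test function, it can be inserted into the first
  order identity, which shows that the iterated derivative is the same function.\<close>

lemma weak_deriv_H1:
  assumes u: "u \<in> sobolev 2 L"
  shows "weak_deriv L 1 u \<in> sobolev 1 L"
    and "AE x in leb L. weak_deriv L 1 (weak_deriv L 1 u) x = weak_deriv L 2 u x"
proof -
  let ?v = "weak_deriv L 1 u"
  note w1 = weak_deriv_spec[OF u one_le_numeral] and w2 = weak_deriv_spec[OF u order_refl]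
  have wd: "is_weak_deriv L 1 ?v (weak_deriv L 2 u)"
    unfolding is_weak_deriv_def
  proof
    fix \<phi> assume \<phi>: "\<phi> \<in> test_functions L"
    have "(LINT x|leb L. u x * deriv (deriv \<phi>) x) = (LINT x|leb L. weak_deriv L 2 u x * \<phi> x)"
      using w2(2) \<phi> by (simp add: is_weak_deriv_def eval_nat_numeral)
    moreover have "(LINT x|leb L. u x * deriv (deriv \<phi>) x) = - (LINT x|leb L. ?v x * deriv \<phi> x)"
      using w1(2) deriv_test_function[OF \<phi>] by (simp add: is_weak_deriv_def)
    ultimately show "(LINT x|leb L. ?v x * (deriv ^^ 1) \<phi> x) = (-1) ^ 1 * (LINT x|leb L. weak_deriv L 2 u x * \<phi> x)"
      by simp
  qed
  have "is_weak_deriv L 0 ?v ?v"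
    by (simp add: is_weak_deriv_def)
  then show v: "?v \<in> sobolev 1 L"
    using wd w1(1) w2(1) by (auto simp: sobolev_def le_Suc_eq)
  show "AE x in leb L. weak_deriv L 1 ?v x = weak_deriv L 2 u x"
    using weak_deriv_spec[OF v, of 1] wd w2(1) by (intro is_weak_deriv_unique) auto
qed

text \<open>In \<open>cont_rep_bound\<close> for the derivative of \<open>u\<close>, the two norms
  are those of the first and second derivative of \<open>u\<close>; both are summands of the second
  order norm, so the same constant serves.\<close>

lemma cont_rep_weak_deriv_le_sobolev_norm:
  assumes "L > 0" and u: "u \<in> sobolev 2 L" and x: "x \<in> {-L..L}"
  shows "\<bar>cont_rep L (weak_deriv L 1 u) x\<bar> \<le> embedding_const L * sobolev_norm 2 L u"
proof -
  let ?v = "weak_deriv L 1 u"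
  note v = weak_deriv_H1[OF u]
  have "L2_norm L (weak_deriv L 1 ?v) = L2_norm L (weak_deriv L 2 u)"
    using v weak_deriv_spec(1)[OF v(1), of 1] weak_deriv_spec(1)[OF u, of 2]
    by (intro L2_norm_cong_AE) auto
  then have "\<bar>cont_rep L ?v x\<bar> \<le> sqrt (2 * L) / (2 * L) * L2_norm L ?v + sqrt (2 * L) * L2_norm L (weak_deriv L 2 u)"
    using cont_rep_bound[OF assms(1) v(1) x] by simp
  also have "\<dots> \<le> sqrt (2 * L) / (2 * L) * sobolev_norm 2 L u + sqrt (2 * L) * sobolev_norm 2 L u"
    using \<open>L > 0\<close> by (intro add_mono mult_left_mono L2_norm_weak_deriv_le) auto
  finally show ?thesis
    by (simp add: embedding_const_def algebra_simps)
qed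

lemma cont_rep_weak_deriv_diff:
  assumes "L > 0" and u: "u \<in> sobolev 2 L" and v: "v \<in> sobolev 2 L" and x: "x \<in> {-L..L}"
  shows "cont_rep L (weak_deriv L 1 (\<lambda>x. u x - v x)) x
    = cont_rep L (weak_deriv L 1 u) x - cont_rep L (weak_deriv L 1 v) x"
proof (rule cont_rep_eqI[OF assms(1) weak_deriv_H1(1)[OF sobolev_diff[OF u v]] _ _ x])
  note u' = weak_deriv_H1(1)[OF u] and v' = weak_deriv_H1(1)[OF v]
  show "continuous_on {-L..L} (\<lambda>x. cont_rep L (weak_deriv L 1 u) x - cont_rep L (weak_deriv L 1 v) x)"
    by (intro continuous_on_diff cont_rep_spec assms u' v')
  have "AE x in leb L. weak_deriv L 1 (\<lambda>x. u x - v x) x = weak_deriv L 1 u x - weak_deriv L 1 v x"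
    by (rule weak_deriv_diff[OF u v]) simp
  then show "AE x in leb L. weak_deriv L 1 (\<lambda>x. u x - v x) x
      = cont_rep L (weak_deriv L 1 u) x - cont_rep L (weak_deriv L 1 v) x"
    using cont_rep_spec(2)[OF assms(1) u'] cont_rep_spec(2)[OF assms(1) v'] by eventually_elim simp
qed

lemma has_real_derivative_le_lipschitz:
  fixes f :: "real \<Rightarrow> real"
  assumes "(f has_real_derivative D) (at x within S)" "at x within S \<noteq> bot"
    and "\<And>y. y \<in> S \<Longrightarrow> \<bar>f y - f x\<bar> \<le> K * \<bar>y - x\<bar>"
  shows "\<bar>D\<bar> \<le> K"
proof (rule tendsto_upperbound[OF _ _ assms(2)])
  show "((\<lambda>y. \<bar>(f y - f x) / (y - x)\<bar>) \<longlongrightarrow> \<bar>D\<bar>) (at x within S)"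
    using assms(1) unfolding has_field_derivative_iff by (rule tendsto_rabs)
  show "\<forall>\<^sub>F y in at x within S. \<bar>(f y - f x) / (y - x)\<bar> \<le> K"
    unfolding eventually_at_filter
    using assms(3) by (intro always_eventually) (auto simp: abs_divide divide_le_eq)
qed

text \<open>In the primitive formula for \<open>u\<close> the weak derivative may be replaced by its
  continuous representative, which makes \<open>u\<close> classically differentiable on the closed
  interval, one-sidedly at its ends. A Lipschitz bound then passes to the difference quotients and
  to their limit. In this way the derivative is bounded from values of \<open>u\<close>
  alone.\<close>

lemma cont_rep_weak_deriv_le_lipschitz:
  assumes "L > 0" and u: "u \<in> sobolev 2 L" and x: "x \<in> {-L..L}"
    and lip: "\<And>y z. -L \<le> y \<Longrightarrow> y \<le> z \<Longrightarrow> z \<le> L \<Longrightarrow> \<bar>cont_rep L u z - cont_rep L u y\<bar> \<le> K * (z - y)"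
  shows "\<bar>cont_rep L (weak_deriv L 1 u) x\<bar> \<le> K"
proof -
  have u1: "u \<in> sobolev 1 L"
    using u sobolev_mono[of 1 2 L] by auto
  let ?V = "cont_rep L (weak_deriv L 1 u)"
  note V = cont_rep_spec[OF assms(1) weak_deriv_H1(1)[OF u]]
  have w: "integrable (leb L) (weak_deriv L 1 u)"
    using weak_deriv_spec(1)[OF u1, of 1] by (simp add: integrable_L2)
  obtain c where c: "\<And>x. x \<in> {-L..L} \<Longrightarrow> cont_rep L u x = c + integral {-L..x} (weak_deriv L 1 u)"
    using cont_rep_primitive[OF assms(1) u1] by blast
  have eq: "cont_rep L u y = c + integral {-L..y} ?V" if "y \<in> {-L..L}" for y
  proof -
    have "(LINT x|leb L. indicator {-L<..<y} x * weak_deriv L 1 u x) = (LINT x|leb L. indicator {-L<..<y} x * ?V x)"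
    proof (rule integral_cong_AE)
      show "AE x in leb L. indicator {-L<..<y} x * weak_deriv L 1 u x = indicator {-L<..<y} x * ?V x"
        using V(2) by eventually_elim simp
    qed (use w borel_measurable_leb_continuous[OF V(1)] in
        \<open>auto intro!: borel_measurable_times[OF measurable_restrict_space1[OF borel_measurable_indicator]]\<close>)
    then show ?thesis
      using integral_leb_interval(1)[OF w, of "-L" y] c[OF that] that
        integral_leb_interval(1)[OF integrable_leb_continuous[OF V(1)], of "-L" y] by simp
  qed
  have "((\<lambda>y. c + integral {-L..y} ?V) has_real_derivative 0 + ?V x) (at x within {-L..L})"
    by (intro DERIV_add DERIV_const integral_has_real_derivative V x)
  then have "((\<lambda>y. c + integral {-L..y} ?V) has_real_derivative ?V x) (at x within {-L..L})"
    by simp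
  moreover have "at x within {-L..L} \<noteq> bot"
    using assms(1) x by (simp add: trivial_limit_within)
  ultimately show ?thesis
  proof (rule has_real_derivative_le_lipschitz)
    fix y assume y: "y \<in> {-L..L}"
    show "\<bar>c + integral {-L..y} ?V - (c + integral {-L..x} ?V)\<bar> \<le> K * \<bar>y - x\<bar>"
      using lip[of x y] lip[of y x] eq[OF x] eq[OF y] x y by (cases "x \<le> y") auto
  qed
qed

section \<open>Operators with the derivative of a Green's function as kernel\<close>

text \<open>Common ground of both operators: \<open>C\<close> stands for the prefactor built from
  the Wronskian, and the hyperbolic functions enter only through smoothness.\<close>

locale green_kernel =
  fixes L C :: real and \<omega>1 \<omega>2 \<omega>1' \<omega>2' :: "real \<Rightarrow> real"
  assumes L: "L > 0"
    and \<omega>1: "\<And>x. (\<omega>1 has_real_derivative \<omega>1' x) (at x)"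
    and \<omega>2: "\<And>x. (\<omega>2 has_real_derivative \<omega>2' x) (at x)"
    and cont': "continuous_on UNIV \<omega>1'" "continuous_on UNIV \<omega>2'"
begin

definition K :: "real \<Rightarrow> real \<Rightarrow> real" where
  "K x \<xi> = C * (if \<xi> \<le> x then \<omega>1 \<xi> * \<omega>2 x else \<omega>1 x * \<omega>2 \<xi>)"

text \<open>The derivative of the kernel in \<xi> off the diagonal. On the diagonal it takes the
  formula valid to its left, whereas the value of \<open>deriv\<close> there is not controlled; the
  explicit form can be estimated everywhere.\<close>

definition K' :: "real \<Rightarrow> real \<Rightarrow> real" where
  "K' x \<xi> = C * (if \<xi> \<le> x then \<omega>1' \<xi> * \<omega>2 x else \<omega>1 x * \<omega>2' \<xi>)"

definition green_op :: "(real \<Rightarrow> real) \<Rightarrow> real \<Rightarrow> real" where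
  "green_op f x = (LINT \<xi>|leb L. deriv (K x) \<xi> * f \<xi>)"

lemma deriv_K:
  assumes "\<xi> \<noteq> x"
  shows "deriv (K x) \<xi> = K' x \<xi>"
proof (rule DERIV_imp_deriv)
  show "(K x has_real_derivative K' x \<xi>) (at \<xi>)"
  proof (cases "\<xi> < x")
    case True
    have "((\<lambda>\<xi>. C * (\<omega>1 \<xi> * \<omega>2 x)) has_real_derivative K' x \<xi>) (at \<xi>)"
      using True by (auto intro!: derivative_eq_intros \<omega>1 simp: K'_def)
    moreover have "\<forall>\<^sub>F y in nhds \<xi>. K x y = C * (\<omega>1 y * \<omega>2 x)"
      using True by (intro eventually_mono[OF eventually_nhds_in_open[of "{..<x}" \<xi>]]) (auto simp: K_def)
    ultimately show ?thesis
      by (simp only: DERIV_cong_ev[OF refl _ refl])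
  next
    case False
    with assms have \<xi>: "x < \<xi>" by simp
    then have "((\<lambda>\<xi>. C * (\<omega>1 x * \<omega>2 \<xi>)) has_real_derivative K' x \<xi>) (at \<xi>)"
      by (auto intro!: derivative_eq_intros \<omega>2 simp: K'_def)
    moreover have "\<forall>\<^sub>F y in nhds \<xi>. K x y = C * (\<omega>1 x * \<omega>2 y)"
      using \<xi> by (intro eventually_mono[OF eventually_nhds_in_open[of "{x<..}" \<xi>]]) (auto simp: K_def)
    ultimately show ?thesis
      by (simp only: DERIV_cong_ev[OF refl _ refl])
  qed
qed

lemma AE_neq: "AE \<xi> in leb L. \<xi> \<noteq> x"
  unfolding AE_leb_iff using AE_completion[OF AE_lborel_singleton[of x]] by eventually_elim simp

lemma measurable_K': "K' x \<in> borel_measurable (leb L)"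
proof -
  have [measurable]: "\<omega>1' \<in> borel_measurable (leb L)" "\<omega>2' \<in> borel_measurable (leb L)"
    "(\<lambda>x. x) \<in> borel_measurable (leb L)"
    using cont' by (auto intro!: borel_measurable_leb_continuous intro: continuous_on_subset)
  show ?thesis
    unfolding K'_def by measurable
qed

text \<open>Only the value at the diagonal point is unknown, and altering a measurable function at
  one point keeps it measurable.\<close>

lemma measurable_deriv_K: "deriv (K x) \<in> borel_measurable (leb L)"
proof -
  have [measurable]: "(\<lambda>x. x) \<in> borel_measurable (leb L)"
    by (rule borel_measurable_leb_continuous) simp
  note [measurable] = measurable_K'
  have "deriv (K x) = (\<lambda>\<xi>. if \<xi> = x then deriv (K x) x else K' x \<xi>)"
    using deriv_K by auto
  also have "\<dots> \<in> borel_measurable (leb L)"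
    by measurable
  finally show ?thesis .
qed

lemma green_op_cong_AE:
  assumes "f \<in> borel_measurable (leb L)" "g \<in> borel_measurable (leb L)" "AE \<xi> in leb L. f \<xi> = g \<xi>"
  shows "green_op f x = green_op g x"
  unfolding green_op_def
proof (rule integral_cong_AE)
  show "AE \<xi> in leb L. deriv (K x) \<xi> * f \<xi> = deriv (K x) \<xi> * g \<xi>"
    using assms(3) by eventually_elim simp
qed (intro borel_measurable_times measurable_deriv_K assms)+

lemma green_op_K':
  assumes "f \<in> borel_measurable (leb L)"
  shows "green_op f x = (LINT \<xi>|leb L. K' x \<xi> * f \<xi>)"
  unfolding green_op_def
proof (rule integral_cong_AE)
  show "AE \<xi> in leb L. deriv (K x) \<xi> * f \<xi> = K' x \<xi> * f \<xi>"
    using AE_neq[of x] by eventually_elim (simp add: deriv_K)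
qed (intro borel_measurable_times measurable_deriv_K measurable_K' assms)+

lemma bounded_on_interval:
  obtains B where "B \<ge> 0" "\<And>x. x \<in> {-L..L} \<Longrightarrow> \<bar>\<omega>1 x\<bar> \<le> B" "\<And>x. x \<in> {-L..L} \<Longrightarrow> \<bar>\<omega>2 x\<bar> \<le> B"
    "\<And>x. x \<in> {-L..L} \<Longrightarrow> \<bar>\<omega>1' x\<bar> \<le> B" "\<And>x. x \<in> {-L..L} \<Longrightarrow> \<bar>\<omega>2' x\<bar> \<le> B"
proof -
  have c: "continuous_on {-L..L} \<omega>1" "continuous_on {-L..L} \<omega>2"
    by (auto intro!: continuous_at_imp_continuous_on DERIV_isCont \<omega>1 \<omega>2)
  have c': "continuous_on {-L..L} \<omega>1'" "continuous_on {-L..L} \<omega>2'"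
    using cont' by (auto intro: continuous_on_subset)
  obtain B1 B2 B3 B4 where B: "\<And>x. x \<in> {-L..L} \<Longrightarrow> \<bar>\<omega>1 x\<bar> \<le> B1" "\<And>x. x \<in> {-L..L} \<Longrightarrow> \<bar>\<omega>2 x\<bar> \<le> B2"
    "\<And>x. x \<in> {-L..L} \<Longrightarrow> \<bar>\<omega>1' x\<bar> \<le> B3" "\<And>x. x \<in> {-L..L} \<Longrightarrow> \<bar>\<omega>2' x\<bar> \<le> B4"
    by (metis continuous_bounded[OF c(1)] continuous_bounded[OF c(2)]
        continuous_bounded[OF c'(1)] continuous_bounded[OF c'(2)])
  define B where "B = max 0 (max (max B1 B2) (max B3 B4))"
  have "B \<ge> 0"
    by (simp add: B_def)
  moreover have "\<bar>\<omega>1 x\<bar> \<le> B" "\<bar>\<omega>2 x\<bar> \<le> B" "\<bar>\<omega>1' x\<bar> \<le> B" "\<bar>\<omega>2' x\<bar> \<le> B" if "x \<in> {-L..L}" for x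
    using B[OF that] by (auto simp: B_def)
  ultimately show thesis
    by (rule that)
qed

lemma K'_bounded:
  obtains B where "B \<ge> 0" "\<And>x \<xi>. x \<in> {-L..L} \<Longrightarrow> \<xi> \<in> {-L..L} \<Longrightarrow> \<bar>K' x \<xi>\<bar> \<le> B"
proof -
  obtain B where B: "B \<ge> 0" "\<And>x. x \<in> {-L..L} \<Longrightarrow> \<bar>\<omega>1 x\<bar> \<le> B" "\<And>x. x \<in> {-L..L} \<Longrightarrow> \<bar>\<omega>2 x\<bar> \<le> B"
    "\<And>x. x \<in> {-L..L} \<Longrightarrow> \<bar>\<omega>1' x\<bar> \<le> B" "\<And>x. x \<in> {-L..L} \<Longrightarrow> \<bar>\<omega>2' x\<bar> \<le> B"
    using bounded_on_interval by blast
  have "\<bar>K' x \<xi>\<bar> \<le> \<bar>C\<bar> * (B * B)" if "x \<in> {-L..L}" "\<xi> \<in> {-L..L}" for x \<xi>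
    unfolding K'_def abs_mult using B that
    by (intro mult_left_mono) (auto simp: abs_mult intro!: mult_mono)
  then show thesis
    using B(1) by (intro that[of "\<bar>C\<bar> * (B * B)"]) auto
qed

text \<open>For these \<xi> both kernels are on the same side of the diagonal, so their difference
  factors into a bounded function of \<xi> and the increment of \<open>\<omega>1\<close> or
  \<open>\<omega>2\<close> from y to z. The point \<xi> = z must be excluded when y < z: it belongs
  to the first branch for z but to the second one for y.\<close>

lemma K'_lipschitz:
  obtains B where "B \<ge> 0" "\<And>y z \<xi>. -L \<le> y \<Longrightarrow> y \<le> z \<Longrightarrow> z \<le> L \<Longrightarrow> \<xi> \<in> {-L..L} \<Longrightarrow> \<xi> \<le> y \<or> z < \<xi> \<Longrightarrow>
    \<bar>K' z \<xi> - K' y \<xi>\<bar> \<le> B * (z - y)"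
proof -
  obtain B where B: "B \<ge> 0" "\<And>x. x \<in> {-L..L} \<Longrightarrow> \<bar>\<omega>1 x\<bar> \<le> B" "\<And>x. x \<in> {-L..L} \<Longrightarrow> \<bar>\<omega>2 x\<bar> \<le> B"
    "\<And>x. x \<in> {-L..L} \<Longrightarrow> \<bar>\<omega>1' x\<bar> \<le> B" "\<And>x. x \<in> {-L..L} \<Longrightarrow> \<bar>\<omega>2' x\<bar> \<le> B"
    using bounded_on_interval by blast
  have lip: "\<bar>f z - f y\<bar> \<le> B * (z - y)"
    if yz: "-L \<le> y" "y \<le> z" "z \<le> L"
      and f: "\<And>x. (f has_real_derivative f' x) (at x)" "\<And>x. x \<in> {-L..L} \<Longrightarrow> \<bar>f' x\<bar> \<le> B"
    for f f' :: "real \<Rightarrow> real" and y z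
  proof (cases "y = z")
    case False
    with yz have "y < z" by simp
    from MVT2[OF this f(1)] obtain x where x: "y < x" "x < z" "f z - f y = (z - y) * f' x"
      by blast
    then have "\<bar>f z - f y\<bar> = (z - y) * \<bar>f' x\<bar>"
      using yz by (simp add: abs_mult)
    also have "\<dots> \<le> (z - y) * B"
      using f(2)[of x] x yz by (intro mult_left_mono) auto
    finally show ?thesis
      by (simp add: mult.commute)
  qed simp
  have "\<bar>K' z \<xi> - K' y \<xi>\<bar> \<le> \<bar>C\<bar> * (B * B) * (z - y)"
    if yz: "-L \<le> y" "y \<le> z" "z \<le> L" and \<xi>: "\<xi> \<in> {-L..L}" "\<xi> \<le> y \<or> z < \<xi>" for y z \<xi>
  proof -
    have "\<bar>K' z \<xi> - K' y \<xi>\<bar> \<le> \<bar>C\<bar> * (B * (B * (z - y)))"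
      using \<xi>(2)
    proof
      assume "\<xi> \<le> y"
      then have "K' z \<xi> - K' y \<xi> = C * (\<omega>1' \<xi> * (\<omega>2 z - \<omega>2 y))"
        using yz by (simp add: K'_def algebra_simps)
      then show ?thesis
        using B(1,4) lip[OF yz \<omega>2 B(5)] \<xi>(1)
        by (simp add: abs_mult) (intro mult_left_mono mult_mono, auto)
    next
      assume "z < \<xi>"
      then have "K' z \<xi> - K' y \<xi> = C * (\<omega>2' \<xi> * (\<omega>1 z - \<omega>1 y))"
        using yz by (simp add: K'_def algebra_simps)
      then show ?thesis
        using B(1,5) lip[OF yz \<omega>1 B(4)] \<xi>(1)
        by (simp add: abs_mult) (intro mult_left_mono mult_mono, auto)
    qed
    then show ?thesis
      by (simp add: mult.assoc)
  qed
  then show thesis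
    using B(1) by (intro that[of "\<bar>C\<bar> * (B * B)"]) auto
qed

lemma integrable_K':
  assumes "continuous_on {-L..L} f" "x \<in> {-L..L}"
  shows "integrable (leb L) (\<lambda>\<xi>. K' x \<xi> * f \<xi>)"
proof -
  obtain B where B: "B \<ge> 0" "\<And>x \<xi>. x \<in> {-L..L} \<Longrightarrow> \<xi> \<in> {-L..L} \<Longrightarrow> \<bar>K' x \<xi>\<bar> \<le> B"
    using K'_bounded by blast
  have "integrable (leb L) (\<lambda>\<xi>. f \<xi> * K' x \<xi>)"
  proof (rule integrable_mult_bounded[OF integrable_leb_continuous[OF assms(1)] measurable_K'])
    show "\<bar>K' x \<xi>\<bar> \<le> B" if "\<xi> \<in> space (leb L)" for \<xi>
      using B(2)[OF assms(2), of \<xi>] that by simp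
  qed
  then show ?thesis
    by (simp add: mult.commute)
qed

lemma green_op_diff:
  assumes "continuous_on {-L..L} f" "continuous_on {-L..L} g" "x \<in> {-L..L}"
  shows "green_op f x - green_op g x = green_op (\<lambda>\<xi>. f \<xi> - g \<xi>) x"
  using integrable_K'[OF assms(1,3)] integrable_K'[OF assms(2,3)]
    borel_measurable_leb_continuous[OF assms(1)] borel_measurable_leb_continuous[OF assms(2)]
    borel_measurable_leb_continuous[OF continuous_on_diff[OF assms(1,2)]]
  by (simp add: green_op_K' right_diff_distrib)

lemma green_op_bound:
  obtains B where "B \<ge> 0" "\<And>f M x. continuous_on {-L..L} f \<Longrightarrow> (\<And>\<xi>. \<xi> \<in> {-L..L} \<Longrightarrow> \<bar>f \<xi>\<bar> \<le> M) \<Longrightarrow>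
    x \<in> {-L..L} \<Longrightarrow> \<bar>green_op f x\<bar> \<le> B * M"
proof -
  interpret finite_measure "leb L" by (rule finite_measure_leb)
  obtain B where B: "B \<ge> 0" "\<And>x \<xi>. x \<in> {-L..L} \<Longrightarrow> \<xi> \<in> {-L..L} \<Longrightarrow> \<bar>K' x \<xi>\<bar> \<le> B"
    using K'_bounded by blast
  have "\<bar>green_op f x\<bar> \<le> (2 * L * B) * M"
    if f: "continuous_on {-L..L} f" "\<And>\<xi>. \<xi> \<in> {-L..L} \<Longrightarrow> \<bar>f \<xi>\<bar> \<le> M" and x: "x \<in> {-L..L}" for f M x
  proof -
    have "\<bar>green_op f x\<bar> \<le> (LINT \<xi>|leb L. \<bar>K' x \<xi> * f \<xi>\<bar>)"
      unfolding green_op_K'[OF borel_measurable_leb_continuous[OF f(1)]] by (rule integral_abs_bound)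
    also have "\<dots> \<le> (LINT \<xi>|leb L. B * M)"
    proof (rule integral_mono[OF Bochner_Integration.integrable_abs[OF integrable_K'[OF f(1) x]]])
      show "\<bar>K' x \<xi> * f \<xi>\<bar> \<le> B * M" if "\<xi> \<in> space (leb L)" for \<xi>
        unfolding abs_mult using B(1) B(2)[OF x, of \<xi>] f(2)[of \<xi>] that by (intro mult_mono) auto
    qed simp
    also have "\<dots> = (2 * L * B) * M"
      using measure_leb[OF L] by simp
    finally show ?thesis .
  qed
  then show thesis
    using B(1) L by (intro that[of "2 * L * B"]) auto
qed

text \<open>The jump of the kernel across the diagonal only matters on an interval of length \<open>z - y\<close>.\<close>

lemma green_op_lipschitz:
  obtains B where "B \<ge> 0" "\<And>f M y z. continuous_on {-L..L} f \<Longrightarrow> (\<And>\<xi>. \<xi> \<in> {-L..L} \<Longrightarrow> \<bar>f \<xi>\<bar> \<le> M) \<Longrightarrow>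
    -L \<le> y \<Longrightarrow> y \<le> z \<Longrightarrow> z \<le> L \<Longrightarrow> \<bar>green_op f z - green_op f y\<bar> \<le> B * M * (z - y)"
proof -
  interpret finite_measure "leb L" by (rule finite_measure_leb)
  obtain B where B: "B \<ge> 0" "\<And>x \<xi>. x \<in> {-L..L} \<Longrightarrow> \<xi> \<in> {-L..L} \<Longrightarrow> \<bar>K' x \<xi>\<bar> \<le> B"
    using K'_bounded by blast
  obtain D where D: "D \<ge> 0" "\<And>y z \<xi>. -L \<le> y \<Longrightarrow> y \<le> z \<Longrightarrow> z \<le> L \<Longrightarrow> \<xi> \<in> {-L..L} \<Longrightarrow> \<xi> \<le> y \<or> z < \<xi> \<Longrightarrow>
      \<bar>K' z \<xi> - K' y \<xi>\<bar> \<le> D * (z - y)"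
    using K'_lipschitz by blast
  have "\<bar>green_op f z - green_op f y\<bar> \<le> (2 * B + 2 * L * D) * M * (z - y)"
    if f: "continuous_on {-L..L} f" "\<And>\<xi>. \<xi> \<in> {-L..L} \<Longrightarrow> \<bar>f \<xi>\<bar> \<le> M" and yz: "-L \<le> y" "y \<le> z" "z \<le> L" for f M y z
  proof -
    have M: "M \<ge> 0"
      using f(2)[of 0] L by auto
    \<comment> \<open>Between y and z the two kernels are bounded separately, which gives
      \<open>2 * B\<close>; elsewhere the Lipschitz bound applies. Its term is kept everywhere so
      that the majorant is an indicator part plus a constant.\<close>
    let ?g = "\<lambda>\<xi>. indicator {y<..<z} \<xi> * (2 * B * M) + D * (z - y) * M"
    have int1: "integrable (leb L) (\<lambda>\<xi>. indicator {y<..<z} \<xi> * (2 * B * M))"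
      by (intro integrable_const_bound[where B = "\<bar>2 * B * M\<bar>"] borel_measurable_times
          measurable_restrict_space1[OF borel_measurable_indicator] AE_I2) (auto simp: indicator_def)
    have int: "integrable (leb L) (\<lambda>\<xi>. K' z \<xi> * f \<xi> - K' y \<xi> * f \<xi>)"
      using yz by (intro Bochner_Integration.integrable_diff integrable_K' f) auto
    \<comment> \<open>At \<xi> = z the kernels are on different branches, but z lies outside the
      open interval where \<open>?g\<close> allows for the jump; a single point is negligible for
      the integral.\<close>
    have pointwise: "\<bar>K' z \<xi> * f \<xi> - K' y \<xi> * f \<xi>\<bar> \<le> ?g \<xi>" if \<xi>: "\<xi> \<in> {-L<..<L}" "\<xi> \<noteq> z" for \<xi>
    proof -
      have "\<bar>K' z \<xi> - K' y \<xi>\<bar> \<le> indicator {y<..<z} \<xi> * (2 * B) + D * (z - y)"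
      proof (cases "\<xi> \<in> {y<..<z}")
        case True
        then have "\<bar>K' z \<xi>\<bar> \<le> B" "\<bar>K' y \<xi>\<bar> \<le> B" "0 \<le> D * (z - y)"
          using yz \<xi> D(1) by (auto intro: B(2))
        then have "\<bar>K' z \<xi> - K' y \<xi>\<bar> \<le> 2 * B + D * (z - y)"
          by linarith
        then show ?thesis
          using True by simp
      next
        case False
        then have "\<xi> \<le> y \<or> z < \<xi>"
          using \<xi> by auto
        then show ?thesis
          using D(2)[OF yz, of \<xi>] \<xi> False by auto
      qed
      moreover have "\<bar>f \<xi>\<bar> \<le> M"
        using f(2)[of \<xi>] \<xi> by auto
      ultimately have "\<bar>K' z \<xi> - K' y \<xi>\<bar> * \<bar>f \<xi>\<bar> \<le> (indicator {y<..<z} \<xi> * (2 * B) + D * (z - y)) * M"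
        using B(1) D(1) yz by (intro mult_mono) (auto simp: indicator_def)
      moreover have "\<bar>K' z \<xi> * f \<xi> - K' y \<xi> * f \<xi>\<bar> = \<bar>K' z \<xi> - K' y \<xi>\<bar> * \<bar>f \<xi>\<bar>"
        by (simp add: left_diff_distrib flip: abs_mult)
      ultimately show ?thesis
        by (simp add: algebra_simps)
    qed
    have "\<bar>green_op f z - green_op f y\<bar> = \<bar>LINT \<xi>|leb L. K' z \<xi> * f \<xi> - K' y \<xi> * f \<xi>\<bar>"
      using yz integrable_K'[OF f(1), of y] integrable_K'[OF f(1), of z]
      by (simp add: green_op_K'[OF borel_measurable_leb_continuous[OF f(1)]])
    also have "\<dots> \<le> (LINT \<xi>|leb L. \<bar>K' z \<xi> * f \<xi> - K' y \<xi> * f \<xi>\<bar>)"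
      by (rule integral_abs_bound)
    also have "\<dots> \<le> (LINT \<xi>|leb L. ?g \<xi>)"
    proof (rule integral_mono_AE)
      show "AE \<xi> in leb L. \<bar>K' z \<xi> * f \<xi> - K' y \<xi> * f \<xi>\<bar> \<le> ?g \<xi>"
        using AE_neq[of z] AE_space by eventually_elim (simp add: pointwise)
    qed (use int int1 in auto)
    also have "\<dots> = (LINT \<xi>|leb L. indicator {y<..<z} \<xi> * (2 * B * M)) + 2 * L * (D * (z - y) * M)"
      using int1 measure_leb[OF L] by simp
    also have "(LINT \<xi>|leb L. indicator {y<..<z} \<xi> * (2 * B * M)) = integral {y..z} (\<lambda>_. 2 * B * M)"
      using yz by (intro integral_leb_interval) auto
    also have "\<dots> = (z - y) * (2 * B * M)"
      using yz by simp
    finally show ?thesis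
      by (simp add: algebra_simps)
  qed
  then show thesis
    using B(1) D(1) L by (intro that[of "2 * B + 2 * L * D"]) auto
qed

end

text \<open>No assumption of the locale constrains the prefactor \<open>C\<close>, so its predicate
  takes only \<open>L\<close> and the four functions. The parameter \<open>c\<close> stands for the
  square root of the dispersion coefficient.\<close>

lemma green_kernel_cosh:
  assumes "L > 0"
  shows "green_kernel L (\<lambda>y. cosh ((L + y) / c)) (\<lambda>y. cosh ((L - y) / c))
    (\<lambda>y. sinh ((L + y) / c) / c) (\<lambda>y. - sinh ((L - y) / c) / c)"
  using assms by unfold_locales
    (auto intro!: derivative_eq_intros continuous_intros simp: divide_inverse)

lemma green_kernel_sinh:
  assumes "L > 0"
  shows "green_kernel L (\<lambda>y. sinh ((L + y) / c)) (\<lambda>y. sinh ((L - y) / c))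
    (\<lambda>y. cosh ((L + y) / c) / c) (\<lambda>y. - cosh ((L - y) / c) / c)"
  using assms by unfold_locales
    (auto intro!: derivative_eq_intros continuous_intros simp: divide_inverse)

section \<open>Continuity in time and uniqueness\<close>

text \<open>Joint continuity on a compact rectangle is uniform, so \<open>g r\<close> tends to
  \<open>g t\<close> uniformly in space, and the operator is bounded for the supremum norm.\<close>

lemma (in green_kernel) continuous_on_green_op:
  fixes g :: "real \<Rightarrow> real \<Rightarrow> real"
  assumes g: "continuous_on ({0..T} \<times> {-L..L}) (\<lambda>p. g (fst p) (snd p))" and x: "x \<in> {-L..L}"
  shows "continuous_on {0..T} (\<lambda>t. green_op (g t) x)"
proof -
  obtain B where B: "B \<ge> 0" "\<And>f M x. continuous_on {-L..L} f \<Longrightarrow> (\<And>\<xi>. \<xi> \<in> {-L..L} \<Longrightarrow> \<bar>f \<xi>\<bar> \<le> M) \<Longrightarrow>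
    x \<in> {-L..L} \<Longrightarrow> \<bar>green_op f x\<bar> \<le> B * M"
    using green_op_bound by blast
  have slice: "continuous_on {-L..L} (g t)" if "t \<in> {0..T}" for t
    by (rule continuous_on_compose2[OF g, where f = "Pair t", simplified])
      (use that in \<open>auto intro!: continuous_intros\<close>)
  have "uniformly_continuous_on ({0..T} \<times> {-L..L}) (\<lambda>p. g (fst p) (snd p))"
    by (intro compact_uniformly_continuous g compact_Times) auto
  note uc = this[unfolded uniformly_continuous_on_def, rule_format]
  show ?thesis
    unfolding continuous_on_iff
  proof (intro ballI allI impI)
    fix t e :: real assume t: "t \<in> {0..T}" and "e > 0"
    \<comment> \<open>Dividing by \<open>B + 1\<close> instead of \<open>B\<close> covers
      \<open>B = 0\<close> and makes the final inequality strict.\<close>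
    then have "e / (B + 1) > 0"
      using B(1) by simp
    from uc[OF this] obtain \<delta> where \<delta>: "\<delta> > 0" "\<And>p q. p \<in> {0..T} \<times> {-L..L} \<Longrightarrow> q \<in> {0..T} \<times> {-L..L} \<Longrightarrow>
        dist q p < \<delta> \<Longrightarrow> dist (g (fst q) (snd q)) (g (fst p) (snd p)) < e / (B + 1)"
      by blast
    have "dist (green_op (g r) x) (green_op (g t) x) < e" if r: "r \<in> {0..T}" "dist r t < \<delta>" for r
    proof -
      have "\<bar>g r \<xi> - g t \<xi>\<bar> \<le> e / (B + 1)" if "\<xi> \<in> {-L..L}" for \<xi>
        using \<delta>(2)[of "(t, \<xi>)" "(r, \<xi>)"] r t that by (simp add: dist_Pair_Pair dist_real_def)
      then have "\<bar>green_op (\<lambda>\<xi>. g r \<xi> - g t \<xi>) x\<bar> \<le> B * (e / (B + 1))"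
        by (intro B(2) x continuous_on_diff slice r t)
      also have "\<dots> < e"
        using B(1) \<open>e > 0\<close> by (simp add: field_simps)
      finally show ?thesis
        by (simp add: dist_real_def green_op_diff[OF slice[OF r(1)] slice[OF t] x])
    qed
    then show "\<exists>d>0. \<forall>r\<in>{0..T}. dist r t < d \<longrightarrow> dist (green_op (g r) x) (green_op (g t) x) < e"
      using \<delta>(1) by blast
  qed
qed

text \<open>The increment in time is small uniformly in space by the embedding estimate
  \<open>le\<close>, the increment in space is small at the fixed time \<open>t\<close>. The map
  \<open>R\<close> allows one argument for a function and for its spatial derivative.\<close>

lemma cont_time_continuous_on:
  fixes R :: "(real \<Rightarrow> real) \<Rightarrow> real \<Rightarrow> real"
  assumes f: "f \<in> cont_time s L T X"
    and cont: "\<And>t. t \<in> {0..T} \<Longrightarrow> continuous_on {-L..L} (R (f t))"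
    and le: "\<And>r t x. r \<in> {0..T} \<Longrightarrow> t \<in> {0..T} \<Longrightarrow> x \<in> {-L..L} \<Longrightarrow>
      \<bar>R (f r) x - R (f t) x\<bar> \<le> c * sobolev_norm s L (\<lambda>x. f r x - f t x)"
  shows "continuous_on ({0..T} \<times> {-L..L}) (\<lambda>p. R (f (fst p)) (snd p))"
  unfolding continuous_on_iff
proof (intro ballI allI impI)
  fix p :: "real \<times> real" and e :: real
  assume p: "p \<in> {0..T} \<times> {-L..L}" and "e > 0"
  obtain t x where tx: "p = (t, x)" "t \<in> {0..T}" "x \<in> {-L..L}"
    using p by auto
  have "((\<lambda>r. c * sobolev_norm s L (\<lambda>x. f r x - f t x)) \<longlongrightarrow> c * 0) (at t within {0..T})"
    using f tx(2) unfolding cont_time_def by (intro tendsto_mult tendsto_const) blast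
  from tendstoD[OF this, of "e / 2"] \<open>e > 0\<close> obtain d1 where d1: "d1 > 0"
    "\<And>r. r \<in> {0..T} \<Longrightarrow> r \<noteq> t \<Longrightarrow> dist r t < d1 \<Longrightarrow> \<bar>c * sobolev_norm s L (\<lambda>x. f r x - f t x)\<bar> < e / 2"
    unfolding eventually_at by (auto simp: dist_real_def)
  obtain d2 where d2: "d2 > 0" "\<And>y. y \<in> {-L..L} \<Longrightarrow> dist y x < d2 \<Longrightarrow> dist (R (f t) y) (R (f t) x) < e / 2"
    using cont[OF tx(2), unfolded continuous_on_iff, rule_format, OF tx(3), of "e / 2"] \<open>e > 0\<close> by auto
  have "dist (R (f (fst q)) (snd q)) (R (f (fst p)) (snd p)) < e"
    if q: "q \<in> {0..T} \<times> {-L..L}" "dist q p < min d1 d2" for q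
  proof -
    obtain r y where ry: "q = (r, y)" "r \<in> {0..T}" "y \<in> {-L..L}"
      using q by auto
    have d: "dist r t < d1" "dist y x < d2"
      using q(2) dist_fst_le[of q p] dist_snd_le[of q p] ry(1) tx(1) by auto
    \<comment> \<open>The limit in time says nothing about r = t, but then the difference is
      0.\<close>
    have "\<bar>R (f r) y - R (f t) y\<bar> < e / 2"
      using le[OF ry(2) tx(2) ry(3)] d1(2)[OF ry(2) _ d(1)] \<open>e > 0\<close> by (cases "r = t") auto
    moreover have "\<bar>R (f t) y - R (f t) x\<bar> < e / 2"
      using d2(2)[OF ry(3) d(2)] by (simp add: dist_real_def)
    ultimately have "\<bar>R (f r) y - R (f t) x\<bar> < e"
      by linarith
    then show ?thesis
      unfolding ry tx by (simp add: dist_real_def)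
  qed
  then show "\<exists>d>0. \<forall>q\<in>{0..T} \<times> {-L..L}. dist q p < d \<longrightarrow>
      dist (R (f (fst q)) (snd q)) (R (f (fst p)) (snd p)) < e"
    using d1(1) d2(1) by (intro exI[of _ "min d1 d2"]) auto
qed

lemma H1T_sobolev: "\<eta> \<in> H1T L T \<Longrightarrow> t \<in> {0..T} \<Longrightarrow> \<eta> t \<in> sobolev 1 L"
  by (simp add: H1T_def cont_time_def)

lemma H2T_sobolev:
  assumes "u \<in> H2T L T" "t \<in> {0..T}"
  shows "u t \<in> sobolev 2 L" "u t \<in> sobolev 1 L"
  using assms sobolev_mono[of 1 2 L] by (auto simp: H2T_def cont_time_def)

lemma sobolev_norm_mono: "s \<le> r \<Longrightarrow> sobolev_norm s L v \<le> sobolev_norm r L v"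
  unfolding sobolev_norm_def by (intro real_sqrt_le_mono sum_mono2) auto

lemma continuous_on_cont_rep_H1T:
  assumes "L > 0" "\<eta> \<in> H1T L T"
  shows "continuous_on ({0..T} \<times> {-L..L}) (\<lambda>p. cont_rep L (\<eta> (fst p)) (snd p))"
proof (rule cont_time_continuous_on[OF assms(2)[unfolded H1T_def]])
  note \<eta> = H1T_sobolev[OF assms(2)]
  fix r t x :: real assume rt: "r \<in> {0..T}" "t \<in> {0..T}" "x \<in> {-L..L}"
  show "\<bar>cont_rep L (\<eta> r) x - cont_rep L (\<eta> t) x\<bar> \<le> embedding_const L * sobolev_norm 1 L (\<lambda>x. \<eta> r x - \<eta> t x)"
    using cont_rep_le_sobolev_norm[OF assms(1) sobolev_diff[OF \<eta> \<eta>] rt(3), OF rt(1,2)]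
      cont_rep_diff[OF assms(1) \<eta> \<eta> rt(3), OF rt(1,2)] by simp
qed (intro cont_rep_spec assms H1T_sobolev[OF assms(2)])

lemma embedding_const_nonneg: "L > 0 \<Longrightarrow> embedding_const L \<ge> 0"
  by (simp add: embedding_const_def)

lemma continuous_on_cont_rep_H2T:
  assumes "L > 0" "u \<in> H2T L T"
  shows "continuous_on ({0..T} \<times> {-L..L}) (\<lambda>p. cont_rep L (u (fst p)) (snd p))"
proof (rule cont_time_continuous_on[OF assms(2)[unfolded H2T_def]])
  note u = H2T_sobolev(2)[OF assms(2)]
  fix r t x :: real assume rt: "r \<in> {0..T}" "t \<in> {0..T}" "x \<in> {-L..L}"
  have "\<bar>cont_rep L (u r) x - cont_rep L (u t) x\<bar> \<le> embedding_const L * sobolev_norm 1 L (\<lambda>x. u r x - u t x)"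
    using cont_rep_le_sobolev_norm[OF assms(1) sobolev_diff[OF u u] rt(3), OF rt(1,2)]
      cont_rep_diff[OF assms(1) u u rt(3), OF rt(1,2)] by simp
  also have "\<dots> \<le> embedding_const L * sobolev_norm 2 L (\<lambda>x. u r x - u t x)"
    by (intro mult_left_mono sobolev_norm_mono embedding_const_nonneg assms(1)) simp
  finally show "\<bar>cont_rep L (u r) x - cont_rep L (u t) x\<bar> \<le> embedding_const L * sobolev_norm 2 L (\<lambda>x. u r x - u t x)" .
qed (intro cont_rep_spec assms H2T_sobolev[OF assms(2)])

lemma continuous_on_cont_rep_weak_deriv_H2T:
  assumes "L > 0" "u \<in> H2T L T"
  shows "continuous_on ({0..T} \<times> {-L..L}) (\<lambda>p. cont_rep L (weak_deriv L 1 (u (fst p))) (snd p))"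
proof (rule cont_time_continuous_on[OF assms(2)[unfolded H2T_def], where R = "\<lambda>v. cont_rep L (weak_deriv L 1 v)"])
  note u = H2T_sobolev(1)[OF assms(2)]
  fix r t x :: real assume rt: "r \<in> {0..T}" "t \<in> {0..T}" "x \<in> {-L..L}"
  show "\<bar>cont_rep L (weak_deriv L 1 (u r)) x - cont_rep L (weak_deriv L 1 (u t)) x\<bar>
      \<le> embedding_const L * sobolev_norm 2 L (\<lambda>x. u r x - u t x)"
    using cont_rep_weak_deriv_le_sobolev_norm[OF assms(1) sobolev_diff[OF u u] rt(3), OF rt(1,2)]
      cont_rep_weak_deriv_diff[OF assms(1) u u rt(3), OF rt(1,2)] by simp
qed (intro cont_rep_spec assms weak_deriv_H1 H2T_sobolev[OF assms(2)])

section \<open>Integrals over time and iteration of an integral inequality\<close>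

lemma set_lebesgue_integral_continuous:
  fixes f g :: "real \<Rightarrow> real"
  assumes "continuous_on {0..t} f" "\<And>\<tau>. \<tau> \<in> {0..t} \<Longrightarrow> g \<tau> = f \<tau>"
  shows "(LINT \<tau>:{0..t}|lebesgue. g \<tau>) = integral {0..t} f"
proof -
  have "(LINT \<tau>:{0..t}|lebesgue. g \<tau>) = (LINT \<tau>:{0..t}|lebesgue. f \<tau>)"
    by (intro set_lebesgue_integral_cong) (use assms(2) in auto)
  also have "\<dots> = integral {0..t} f"
    by (intro set_lebesgue_integral_eq_integral absolutely_integrable_continuous_real assms)
  finally show ?thesis .
qed

lemma integral_diff_le:
  fixes f g m :: "real \<Rightarrow> real"
  assumes "continuous_on {0..t} f" "continuous_on {0..t} g" "continuous_on {0..t} m"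
    and "\<And>\<tau>. \<tau> \<in> {0..t} \<Longrightarrow> \<bar>f \<tau> - g \<tau>\<bar> \<le> c * m \<tau>"
  shows "\<bar>integral {0..t} f - integral {0..t} g\<bar> \<le> c * integral {0..t} m"
proof -
  have i: "f integrable_on {0..t}" "g integrable_on {0..t}" "m integrable_on {0..t}"
    by (intro integrable_continuous_real assms)+
  have "norm (integral {0..t} (\<lambda>\<tau>. f \<tau> - g \<tau>)) \<le> integral {0..t} (\<lambda>\<tau>. c * m \<tau>)"
    using assms(4) i by (intro integral_norm_bound_integral integrable_diff integrable_on_mult_right) auto
  then show ?thesis
    using i by (simp add: Henstock_Kurzweil_Integration.integral_diff)
qed

text \<open>
  A Gronwall inequality for pointwise bounds: it needs no measurability of the supremum over space as
  a function of time.
\<close>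

lemma picard_iteration:
  fixes Q :: "real \<Rightarrow> real \<Rightarrow> bool"
  assumes base: "\<And>t. t \<in> {0..T} \<Longrightarrow> Q t B"
    and step: "\<And>m t. continuous_on {0..T} m \<Longrightarrow> (\<And>\<tau>. \<tau> \<in> {0..T} \<Longrightarrow> Q \<tau> (m \<tau>)) \<Longrightarrow> t \<in> {0..T} \<Longrightarrow>
      Q t (C * integral {0..t} m)"
  shows "t \<in> {0..T} \<Longrightarrow> Q t (B * (inverse (fact n) * (C * t) ^ n))"
proof (induction n arbitrary: t)
  case 0
  then show ?case
    using base by simp
next
  case (Suc n)
  \<comment> \<open>These are the iterates, from the constant \<open>B\<close>, of the map sending
    \<open>m\<close> to \<open>C\<close> times its integral from 0: each vanishes at 0 for positive
    index and has \<open>C\<close> times its predecessor as derivative.\<close>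
  let ?m = "\<lambda>n t. B * (inverse (fact n) * (C * t) ^ n)"
  have "(?m (Suc n) has_real_derivative C * ?m n \<tau>) (at \<tau> within S)" for \<tau> S
  proof (rule DERIV_cong)
    show "(?m (Suc n) has_real_derivative B * (inverse (fact (Suc n)) * ((1 + real n) * (C * (C * \<tau>) ^ n))))
        (at \<tau> within S)"
      by (intro DERIV_cmult DERIV_power_Suc DERIV_cmult_Id)
    show "B * (inverse (fact (Suc n)) * ((1 + real n) * (C * (C * \<tau>) ^ n))) = C * ?m n \<tau>"
    proof -
      have "(1 + real n) * inverse (1 + real n) = 1"
        by (rule right_inverse) linarith
      then have "inverse (fact (Suc n)) * (1 + real n) = inverse (fact n)"
        by (simp add: mult_ac)
      then have key: "inverse (fact (Suc n)) * ((1 + real n) * y) = inverse (fact n) * y" for y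
        by (metis mult.assoc)
      show ?thesis
        unfolding key by (simp only: mult_ac)
    qed
  qed
  then have "((\<lambda>\<tau>. C * ?m n \<tau>) has_integral ?m (Suc n) t - ?m (Suc n) 0) {0..t}"
    using Suc.prems by (intro fundamental_theorem_of_calculus)
      (auto simp flip: has_real_derivative_iff_has_vector_derivative)
  then have "integral {0..t} (\<lambda>\<tau>. C * ?m n \<tau>) = ?m (Suc n) t - ?m (Suc n) 0"
    by (rule integral_unique)
  moreover have "?m (Suc n) 0 = 0"
    by simp
  moreover have "integral {0..t} (\<lambda>\<tau>. C * ?m n \<tau>) = C * integral {0..t} (?m n)"
    by (rule Henstock_Kurzweil_Integration.integral_mult_right)
  ultimately have "C * integral {0..t} (?m n) = ?m (Suc n) t"
    by (simp only: diff_zero)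
  moreover have "Q t (C * integral {0..t} (?m n))"
    by (intro step Suc) (auto intro!: continuous_intros)
  ultimately show ?case
    by (simp only:)
qed

text \<open>The bounds are multiples of the terms of the convergent exponential series and so tend
  to 0.\<close>

lemma zero_if_le_exp_terms:
  fixes y B z :: real
  assumes "\<And>n. \<bar>y\<bar> \<le> B * (inverse (fact n) * z ^ n)"
  shows "y = 0"
proof -
  have "(\<lambda>n. B * (inverse (fact n) * z ^ n)) \<longlonglongrightarrow> B * 0"
    by (intro tendsto_mult tendsto_const summable_LIMSEQ_zero summable_exp)
  then have "\<bar>y\<bar> \<le> B * 0"
    using assms by (intro LIMSEQ_le_const) auto
  then show ?thesis
    by simp
qed

section \<open>Integral inequality for the difference of two solutions\<close>

theorem proposition3p1:
  fixes L a b d T :: real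
    and \<eta>0 u0 :: "real \<Rightarrow> real"
    and \<eta>1 \<eta>2 u1 u2 :: "real \<Rightarrow> real \<Rightarrow> real"
  assumes "L > 0" and "a < 0" and "b > 0" and "d > 0" and "a + b + d = 1 / 3"
    and "0 < T"
    and "\<eta>0 \<in> sobolev 1 L" and "u0 \<in> sobolev 2 L \<inter> H10 L"
    and "\<eta>1 \<in> H1T L T" and "u1 \<in> H2T L T" and "is_solution a b d L T \<eta>0 u0 \<eta>1 u1"
    and "\<eta>2 \<in> H1T L T" and "u2 \<in> H2T L T" and "is_solution a b d L T \<eta>0 u0 \<eta>2 u2"
  shows "\<forall>t\<in>{0..T}. (AE x in leb L. \<eta>1 t x = \<eta>2 t x) \<and> (AE x in leb L. u1 t x = u2 t x)"
proof -
  let ?S = "{0..T} \<times> {-L..L}"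
  \<comment> \<open>The prefactor is written with the Wronskian substituted, exactly as
    \<open>green_F\<close> unfolds, so that the kernels agree syntactically; likewise for
    \<open>D\<close> below.\<close>
  interpret N: green_kernel L "- (1 / (b * (- (1 / sqrt b) * sinh (2 * L / sqrt b))))"
    "\<lambda>y. cosh ((L + y) / sqrt b)" "\<lambda>y. cosh ((L - y) / sqrt b)"
    "\<lambda>y. sinh ((L + y) / sqrt b) / sqrt b" "\<lambda>y. - sinh ((L - y) / sqrt b) / sqrt b"
    by (rule green_kernel_cosh[OF \<open>L > 0\<close>])
  interpret D: green_kernel L "- (1 / (d * (- (1 / sqrt d) * sinh (2 * L / sqrt d))))"
    "\<lambda>y. sinh ((L + y) / sqrt d)" "\<lambda>y. sinh ((L - y) / sqrt d)"
    "\<lambda>y. cosh ((L + y) / sqrt d) / sqrt d" "\<lambda>y. - cosh ((L - y) / sqrt d) / sqrt d"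
    by (rule green_kernel_sinh[OF \<open>L > 0\<close>])
  have "green_F b L x = N.K x" for x
    by (rule ext) (simp only: green_F_def Let_def N.K_def)
  then have LN: "LN b L f x = N.green_op f x" for f x
    by (simp only: LN_def N.green_op_def)
  have "green_G d L x = D.K x" for x
    by (rule ext) (simp only: green_G_def Let_def D.K_def)
  then have LD: "LD d L f x = D.green_op f x" for f x
    by (simp only: LD_def D.green_op_def)

  \<comment> \<open>\<open>E\<close> serves elevations and velocities alike. \<open>h\<close> and
    \<open>k\<close> are the arguments of the two operators formed with continuous representatives:
    they agree almost everywhere with those in \<open>is_solution\<close>, so the operators have the
    same values, and they are jointly continuous.\<close>
  define E where "E \<eta> t = cont_rep L (\<eta> t)" for \<eta> :: "real \<Rightarrow> real \<Rightarrow> real" and t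
  define V where "V u t = cont_rep L (weak_deriv L 1 (u t))" for u :: "real \<Rightarrow> real \<Rightarrow> real" and t
  define h where "h \<eta> u t \<xi> = (a + b) / b * E u t \<xi> + E \<eta> t \<xi> * E u t \<xi>" for \<eta> u t \<xi>
  define k where "k \<eta> u t \<xi> = E \<eta> t \<xi> + 1 / 2 * (E u t \<xi>)\<^sup>2" for \<eta> u t \<xi>

  have cE: "continuous_on ?S (\<lambda>p. E \<eta> (fst p) (snd p))" if "\<eta> \<in> H1T L T" for \<eta>
    using continuous_on_cont_rep_H1T[OF \<open>L > 0\<close> that] by (simp add: E_def)
  have cU: "continuous_on ?S (\<lambda>p. E u (fst p) (snd p))" if "u \<in> H2T L T" for u
    using continuous_on_cont_rep_H2T[OF \<open>L > 0\<close> that] by (simp add: E_def)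
  have cV: "continuous_on ?S (\<lambda>p. V u (fst p) (snd p))" if "u \<in> H2T L T" for u
    using continuous_on_cont_rep_weak_deriv_H2T[OF \<open>L > 0\<close> that] by (simp add: V_def)
  have ch: "continuous_on ?S (\<lambda>p. h \<eta> u (fst p) (snd p))" and ck: "continuous_on ?S (\<lambda>p. k \<eta> u (fst p) (snd p))"
    if "\<eta> \<in> H1T L T" "u \<in> H2T L T" for \<eta> u
    unfolding h_def k_def by (intro continuous_intros cE cU that)+
  have slice_t: "continuous_on {0..t} (\<lambda>\<tau>. f \<tau> x)"
    if "continuous_on ?S (\<lambda>p. f (fst p) (snd p))" "t \<in> {0..T}" "x \<in> {-L..L}"
    for f :: "real \<Rightarrow> real \<Rightarrow> real" and t x
    by (rule continuous_on_compose2[OF that(1), where f = "\<lambda>\<tau>. (\<tau>, x)", simplified])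
      (use that in \<open>auto intro!: continuous_intros\<close>)
  have slice_x: "continuous_on {-L..L} (f t)"
    if "continuous_on ?S (\<lambda>p. f (fst p) (snd p))" "t \<in> {0..T}" for f :: "real \<Rightarrow> real \<Rightarrow> real" and t
    by (rule continuous_on_compose2[OF that(1), where f = "Pair t", simplified])
      (use that in \<open>auto intro!: continuous_intros\<close>)
  have bdd: "\<exists>B. \<forall>t\<in>{0..T}. \<forall>x\<in>{-L..L}. \<bar>f t x\<bar> \<le> B"
    if "continuous_on ?S (\<lambda>p. f (fst p) (snd p))" for f :: "real \<Rightarrow> real \<Rightarrow> real"
  proof -
    have "bounded ((\<lambda>p. f (fst p) (snd p)) ` ?S)"
      by (intro compact_imp_bounded compact_continuous_image that compact_Times) auto
    then show ?thesis
      unfolding bounded_iff by force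
  qed
  have op_t: "continuous_on {0..t} (\<lambda>\<tau>. N.green_op (h \<eta> u \<tau>) x + a / b * V u \<tau> x)"
    "continuous_on {0..t} (\<lambda>\<tau>. D.green_op (k \<eta> u \<tau>) x)"
    if "\<eta> \<in> H1T L T" "u \<in> H2T L T" "t \<in> {0..T}" "x \<in> {-L..L}" for \<eta> u t x
  proof -
    have "{0..t} \<subseteq> {0..T}"
      using that by auto
    note sub = continuous_on_subset[OF _ this]
    show "continuous_on {0..t} (\<lambda>\<tau>. N.green_op (h \<eta> u \<tau>) x + a / b * V u \<tau> x)"
      by (rule continuous_on_add[OF sub[OF N.continuous_on_green_op[OF ch[OF that(1,2)] that(4)]]
            continuous_on_mult_left[OF slice_t[OF cV[OF that(2)] that(3,4)]]])
    show "continuous_on {0..t} (\<lambda>\<tau>. D.green_op (k \<eta> u \<tau>) x)"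
      by (rule sub[OF D.continuous_on_green_op[OF ck[OF that(1,2)] that(4)]])
  qed

  have sol: "E \<eta> t x = cont_rep L \<eta>0 x + integral {0..t} (\<lambda>\<tau>. N.green_op (h \<eta> u \<tau>) x + a / b * V u \<tau> x)"
    "E u t x = cont_rep L u0 x + integral {0..t} (\<lambda>\<tau>. D.green_op (k \<eta> u \<tau>) x)"
    if \<eta>: "\<eta> \<in> H1T L T" and u: "u \<in> H2T L T" and s: "is_solution a b d L T \<eta>0 u0 \<eta> u"
      and t: "t \<in> {0..T}" and x: "x \<in> {-L..L}" for \<eta> u t x
  proof -
    have eqs: "LN b L (\<lambda>\<xi>. (a + b) / b * u \<tau> \<xi> + \<eta> \<tau> \<xi> * u \<tau> \<xi>) x = N.green_op (h \<eta> u \<tau>) x"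
      "LD d L (\<lambda>\<xi>. \<eta> \<tau> \<xi> + 1 / 2 * (u \<tau> \<xi>)\<^sup>2) x = D.green_op (k \<eta> u \<tau>) x" if "\<tau> \<in> {0..t}" for \<tau>
    proof -
      have \<tau>: "\<tau> \<in> {0..T}"
        using that t by auto
      note \<eta>\<tau> = H1T_sobolev[OF \<eta> \<tau>] and u\<tau> = H2T_sobolev(2)[OF u \<tau>]
      have [measurable]: "\<eta> \<tau> \<in> borel_measurable (leb L)" "u \<tau> \<in> borel_measurable (leb L)"
        using sobolev_L2[OF \<eta>\<tau>] sobolev_L2[OF u\<tau>] by (auto simp: L2_def)
      note ae = cont_rep_spec(2)[OF \<open>L > 0\<close> \<eta>\<tau>] cont_rep_spec(2)[OF \<open>L > 0\<close> u\<tau>]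
      show "LN b L (\<lambda>\<xi>. (a + b) / b * u \<tau> \<xi> + \<eta> \<tau> \<xi> * u \<tau> \<xi>) x = N.green_op (h \<eta> u \<tau>) x"
        unfolding LN
      proof (rule N.green_op_cong_AE)
        show "AE \<xi> in leb L. (a + b) / b * u \<tau> \<xi> + \<eta> \<tau> \<xi> * u \<tau> \<xi> = h \<eta> u \<tau> \<xi>"
          using ae by eventually_elim (simp add: h_def E_def)
      qed (use borel_measurable_leb_continuous[OF slice_x[OF ch[OF \<eta> u] \<tau>]] in measurable)
      show "LD d L (\<lambda>\<xi>. \<eta> \<tau> \<xi> + 1 / 2 * (u \<tau> \<xi>)\<^sup>2) x = D.green_op (k \<eta> u \<tau>) x"
        unfolding LD
      proof (rule D.green_op_cong_AE)
        show "AE \<xi> in leb L. \<eta> \<tau> \<xi> + 1 / 2 * (u \<tau> \<xi>)\<^sup>2 = k \<eta> u \<tau> \<xi>"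
          using ae by eventually_elim (simp add: k_def E_def)
      qed (use borel_measurable_leb_continuous[OF slice_x[OF ck[OF \<eta> u] \<tau>]] in measurable)
    qed
    have i1: "(LINT \<tau>:{0..t}|lebesgue. LN b L (\<lambda>\<xi>. (a + b) / b * u \<tau> \<xi> + \<eta> \<tau> \<xi> * u \<tau> \<xi>) x
        + a / b * cont_rep L (weak_deriv L 1 (u \<tau>)) x)
      = integral {0..t} (\<lambda>\<tau>. N.green_op (h \<eta> u \<tau>) x + a / b * V u \<tau> x)"
      by (rule set_lebesgue_integral_continuous[OF op_t(1)[OF \<eta> u t x]]) (simp only: eqs V_def)
    have i2: "(LINT \<tau>:{0..t}|lebesgue. LD d L (\<lambda>\<xi>. \<eta> \<tau> \<xi> + 1 / 2 * (u \<tau> \<xi>)\<^sup>2) x)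
      = integral {0..t} (\<lambda>\<tau>. D.green_op (k \<eta> u \<tau>) x)"
      by (rule set_lebesgue_integral_continuous[OF op_t(2)[OF \<eta> u t x]]) (simp only: eqs)
    note s' = s[unfolded is_solution_def, rule_format, OF t x]
    show "E \<eta> t x = cont_rep L \<eta>0 x + integral {0..t} (\<lambda>\<tau>. N.green_op (h \<eta> u \<tau>) x + a / b * V u \<tau> x)"
      using conjunct1[OF s'] unfolding i1 by (simp only: E_def)
    show "E u t x = cont_rep L u0 x + integral {0..t} (\<lambda>\<tau>. D.green_op (k \<eta> u \<tau>) x)"
      using conjunct2[OF s'] unfolding i2 by (simp only: E_def)
  qed

  note in1 = \<open>\<eta>1 \<in> H1T L T\<close> \<open>u1 \<in> H2T L T\<close> and in2 = \<open>\<eta>2 \<in> H1T L T\<close> \<open>u2 \<in> H2T L T\<close>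
  note sol1 = sol[OF in1 \<open>is_solution a b d L T \<eta>0 u0 \<eta>1 u1\<close>]
    and sol2 = sol[OF in2 \<open>is_solution a b d L T \<eta>0 u0 \<eta>2 u2\<close>]

  obtain B1 B2 B3 B4 where B: "\<forall>t\<in>{0..T}. \<forall>x\<in>{-L..L}. \<bar>E \<eta>1 t x\<bar> \<le> B1"
    "\<forall>t\<in>{0..T}. \<forall>x\<in>{-L..L}. \<bar>E \<eta>2 t x\<bar> \<le> B2" "\<forall>t\<in>{0..T}. \<forall>x\<in>{-L..L}. \<bar>E u1 t x\<bar> \<le> B3"
    "\<forall>t\<in>{0..T}. \<forall>x\<in>{-L..L}. \<bar>E u2 t x\<bar> \<le> B4"
    using bdd[OF cE[OF in1(1)]] bdd[OF cE[OF in2(1)]] bdd[OF cU[OF in1(2)]] bdd[OF cU[OF in2(2)]] by blast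
  obtain B5 B6 where B': "\<forall>t\<in>{0..T}. \<forall>x\<in>{-L..L}. \<bar>V u1 t x\<bar> \<le> B5" "\<forall>t\<in>{0..T}. \<forall>x\<in>{-L..L}. \<bar>V u2 t x\<bar> \<le> B6"
    using bdd[OF cV[OF in1(2)]] bdd[OF cV[OF in2(2)]] by blast
  \<comment> \<open>One bound for both solutions and their velocity derivatives; it makes the
    quadratic terms Lipschitz. The 0 in the maximum provides \<open>M \<ge> 0\<close>
    directly.\<close>
  define M where "M = max 0 (max (max B1 B2) (max (max B3 B4) (max B5 B6)))"
  have le: "B1 \<le> M" "B2 \<le> M" "B3 \<le> M" "B4 \<le> M" "B5 \<le> M" "B6 \<le> M"
    unfolding M_def by linarith+
  have M: "\<bar>E \<eta>1 t x\<bar> \<le> M" "\<bar>E \<eta>2 t x\<bar> \<le> M" "\<bar>E u1 t x\<bar> \<le> M" "\<bar>E u2 t x\<bar> \<le> M" "\<bar>V u1 t x\<bar> \<le> M" "\<bar>V u2 t x\<bar> \<le> M"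
    if "t \<in> {0..T}" "x \<in> {-L..L}" for t x
    using B[rule_format, OF that] B'[rule_format, OF that] le by linarith+
  have "M \<ge> 0"
    by (simp add: M_def)

  obtain CN where CN: "CN \<ge> 0" "\<And>f M x. continuous_on {-L..L} f \<Longrightarrow> (\<And>\<xi>. \<xi> \<in> {-L..L} \<Longrightarrow> \<bar>f \<xi>\<bar> \<le> M) \<Longrightarrow>
    x \<in> {-L..L} \<Longrightarrow> \<bar>N.green_op f x\<bar> \<le> CN * M"
    using N.green_op_bound by blast
  obtain CD where CD: "CD \<ge> 0" "\<And>f M x. continuous_on {-L..L} f \<Longrightarrow> (\<And>\<xi>. \<xi> \<in> {-L..L} \<Longrightarrow> \<bar>f \<xi>\<bar> \<le> M) \<Longrightarrow>
    x \<in> {-L..L} \<Longrightarrow> \<bar>D.green_op f x\<bar> \<le> CD * M"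
    using D.green_op_bound by blast
  obtain CL where CL: "CL \<ge> 0" "\<And>f M y z. continuous_on {-L..L} f \<Longrightarrow> (\<And>\<xi>. \<xi> \<in> {-L..L} \<Longrightarrow> \<bar>f \<xi>\<bar> \<le> M) \<Longrightarrow>
    -L \<le> y \<Longrightarrow> y \<le> z \<Longrightarrow> z \<le> L \<Longrightarrow> \<bar>D.green_op f z - D.green_op f y\<bar> \<le> CL * M * (z - y)"
    using D.green_op_lipschitz by blast
  \<comment> \<open>Bounds for \<open>e\<close>, for \<open>w\<close> and for the Lipschitz constant
    of \<open>w\<close>. The factors \<open>\<bar>(a + b) / b\<bar> + 2 * M\<close> and
    \<open>1 + M\<close> are the Lipschitz constants of \<open>h\<close> and \<open>k\<close>
    established below, and \<open>\<bar>a / b\<bar>\<close> belongs to the velocity derivative in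
    the first equation. All three are nonnegative, so their sum dominates each.\<close>
  define c1 where "c1 = CN * (\<bar>(a + b) / b\<bar> + 2 * M) + \<bar>a / b\<bar>"
  define c2 where "c2 = CD * (1 + M)"
  define c3 where "c3 = CL * (1 + M)"
  define C where "C = c1 + c2 + c3"
  have c: "0 \<le> c1" "0 \<le> c2" "0 \<le> c3"
    using CN(1) CD(1) CL(1) \<open>M \<ge> 0\<close> by (simp_all add: c1_def c2_def c3_def)

  define Q where "Q t m \<longleftrightarrow> (\<forall>x\<in>{-L..L}. \<bar>E \<eta>1 t x - E \<eta>2 t x\<bar> \<le> m \<and> \<bar>E u1 t x - E u2 t x\<bar> \<le> m \<and>
    \<bar>V u1 t x - V u2 t x\<bar> \<le> m)" for t m
  have Q0: "Q t (2 * M)" if "t \<in> {0..T}" for t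
    unfolding Q_def
  proof
    fix x assume "x \<in> {-L..L}"
    from M[OF that this] show "\<bar>E \<eta>1 t x - E \<eta>2 t x\<bar> \<le> 2 * M \<and> \<bar>E u1 t x - E u2 t x\<bar> \<le> 2 * M \<and>
      \<bar>V u1 t x - V u2 t x\<bar> \<le> 2 * M"
      by linarith
  qed

  have step: "Q t (C * integral {0..t} m)"
    if m: "continuous_on {0..T} m" and Qm: "\<And>\<tau>. \<tau> \<in> {0..T} \<Longrightarrow> Q \<tau> (m \<tau>)" and t: "t \<in> {0..T}" for m t
  proof -
    have tT: "{0..t} \<subseteq> {0..T}"
      using t by auto
    have m': "continuous_on {0..t} m"
      by (rule continuous_on_subset[OF m tT])
    have q: "\<bar>E \<eta>1 \<tau> x - E \<eta>2 \<tau> x\<bar> \<le> m \<tau>" "\<bar>E u1 \<tau> x - E u2 \<tau> x\<bar> \<le> m \<tau>" "\<bar>V u1 \<tau> x - V u2 \<tau> x\<bar> \<le> m \<tau>"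
      if "\<tau> \<in> {0..T}" "x \<in> {-L..L}" for \<tau> x
      using Qm[OF that(1)] that(2) unfolding Q_def by auto
    \<comment> \<open>The sign of \<open>m\<close> is inherited from the absolute values it bounds,
      evaluated at the point 0 of the interval.\<close>
    have m0: "m \<tau> \<ge> 0" if "\<tau> \<in> {0..T}" for \<tau>
      using q(1)[OF that, of 0] \<open>L > 0\<close> by auto
    have I: "integral {0..t} m \<ge> 0"
      using m0 tT by (intro integral_nonneg integrable_continuous_real m') auto
    have dh: "\<bar>h \<eta>1 u1 \<tau> \<xi> - h \<eta>2 u2 \<tau> \<xi>\<bar> \<le> (\<bar>(a + b) / b\<bar> + 2 * M) * m \<tau>"
      and dk: "\<bar>k \<eta>1 u1 \<tau> \<xi> - k \<eta>2 u2 \<tau> \<xi>\<bar> \<le> (1 + M) * m \<tau>" if "\<tau> \<in> {0..T}" "\<xi> \<in> {-L..L}" for \<tau> \<xi>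
    proof -
      note q' = q[OF that] and M' = M[OF that]
      \<comment> \<open>The difference of the products is split through the mixed product
        \<open>E \<eta>1 \<tau> \<xi> * E u2 \<tau> \<xi>\<close>: each summand is a bounded factor
        times one of the differences.\<close>
      have "h \<eta>1 u1 \<tau> \<xi> - h \<eta>2 u2 \<tau> \<xi> = (a + b) / b * (E u1 \<tau> \<xi> - E u2 \<tau> \<xi>)
          + E \<eta>1 \<tau> \<xi> * (E u1 \<tau> \<xi> - E u2 \<tau> \<xi>) + E u2 \<tau> \<xi> * (E \<eta>1 \<tau> \<xi> - E \<eta>2 \<tau> \<xi>)"
        by (simp add: h_def algebra_simps del: times_divide_eq_left)
      moreover have "\<bar>(a + b) / b * (E u1 \<tau> \<xi> - E u2 \<tau> \<xi>)\<bar> \<le> \<bar>(a + b) / b\<bar> * m \<tau>"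
        unfolding abs_mult by (rule mult_left_mono[OF q'(2)]) simp
      moreover have "\<bar>E \<eta>1 \<tau> \<xi> * (E u1 \<tau> \<xi> - E u2 \<tau> \<xi>)\<bar> \<le> M * m \<tau>"
        unfolding abs_mult by (rule mult_mono[OF M'(1) q'(2) \<open>M \<ge> 0\<close>]) simp
      moreover have "\<bar>E u2 \<tau> \<xi> * (E \<eta>1 \<tau> \<xi> - E \<eta>2 \<tau> \<xi>)\<bar> \<le> M * m \<tau>"
        unfolding abs_mult by (rule mult_mono[OF M'(4) q'(1) \<open>M \<ge> 0\<close>]) simp
      ultimately have "\<bar>h \<eta>1 u1 \<tau> \<xi> - h \<eta>2 u2 \<tau> \<xi>\<bar> \<le> \<bar>(a + b) / b\<bar> * m \<tau> + M * m \<tau> + M * m \<tau>"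
        by linarith
      then show "\<bar>h \<eta>1 u1 \<tau> \<xi> - h \<eta>2 u2 \<tau> \<xi>\<bar> \<le> (\<bar>(a + b) / b\<bar> + 2 * M) * m \<tau>"
        by (simp add: distrib_right)
      \<comment> \<open>The difference of the squares factors, and the mean of the two velocities is
        bounded by \<open>M\<close>.\<close>
      have "k \<eta>1 u1 \<tau> \<xi> - k \<eta>2 u2 \<tau> \<xi> = (E \<eta>1 \<tau> \<xi> - E \<eta>2 \<tau> \<xi>)
          + (E u1 \<tau> \<xi> + E u2 \<tau> \<xi>) / 2 * (E u1 \<tau> \<xi> - E u2 \<tau> \<xi>)"
        by (simp add: k_def field_simps power2_eq_square)
      moreover have "\<bar>(E u1 \<tau> \<xi> + E u2 \<tau> \<xi>) / 2\<bar> \<le> M"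
        using M'(3,4) by (auto simp: abs_le_iff)
      then have "\<bar>(E u1 \<tau> \<xi> + E u2 \<tau> \<xi>) / 2 * (E u1 \<tau> \<xi> - E u2 \<tau> \<xi>)\<bar> \<le> M * m \<tau>"
        unfolding abs_mult by (rule mult_mono[OF _ q'(2) \<open>M \<ge> 0\<close>]) simp
      ultimately have "\<bar>k \<eta>1 u1 \<tau> \<xi> - k \<eta>2 u2 \<tau> \<xi>\<bar> \<le> m \<tau> + M * m \<tau>"
        using q'(1) by linarith
      then show "\<bar>k \<eta>1 u1 \<tau> \<xi> - k \<eta>2 u2 \<tau> \<xi>\<bar> \<le> (1 + M) * m \<tau>"
        by (simp add: distrib_right)
    qed
    have hc: "continuous_on {-L..L} (h \<eta>1 u1 \<tau>)" "continuous_on {-L..L} (h \<eta>2 u2 \<tau>)"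
      "continuous_on {-L..L} (k \<eta>1 u1 \<tau>)" "continuous_on {-L..L} (k \<eta>2 u2 \<tau>)" if "\<tau> \<in> {0..T}" for \<tau>
      by (intro slice_x ch ck in1 in2 that)+

    have e: "\<bar>E \<eta>1 t x - E \<eta>2 t x\<bar> \<le> c1 * integral {0..t} m" if x: "x \<in> {-L..L}" for x
    proof -
      have "\<bar>N.green_op (h \<eta>1 u1 \<tau>) x + a / b * V u1 \<tau> x - (N.green_op (h \<eta>2 u2 \<tau>) x + a / b * V u2 \<tau> x)\<bar> \<le> c1 * m \<tau>"
        if "\<tau> \<in> {0..t}" for \<tau>
      proof -
        have \<tau>: "\<tau> \<in> {0..T}"
          using that tT by auto
        have "\<bar>N.green_op (h \<eta>1 u1 \<tau>) x - N.green_op (h \<eta>2 u2 \<tau>) x\<bar> \<le> CN * ((\<bar>(a + b) / b\<bar> + 2 * M) * m \<tau>)"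
          unfolding N.green_op_diff[OF hc(1,2)[OF \<tau>] x]
          by (intro CN(2) continuous_on_diff hc \<tau> x dh)
        moreover have "\<bar>a / b * V u1 \<tau> x - a / b * V u2 \<tau> x\<bar> \<le> \<bar>a / b\<bar> * m \<tau>"
          unfolding right_diff_distrib[symmetric] abs_mult by (intro mult_left_mono q \<tau> x) simp
        ultimately have "\<bar>N.green_op (h \<eta>1 u1 \<tau>) x + a / b * V u1 \<tau> x - (N.green_op (h \<eta>2 u2 \<tau>) x + a / b * V u2 \<tau> x)\<bar>
            \<le> CN * ((\<bar>(a + b) / b\<bar> + 2 * M) * m \<tau>) + \<bar>a / b\<bar> * m \<tau>"
          by linarith
        then show ?thesis
          unfolding c1_def by (simp only: distrib_right mult.assoc)
      qed
      from integral_diff_le[OF op_t(1)[OF in1 t x] op_t(1)[OF in2 t x] m' this]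
      show ?thesis
        by (simp add: sol1(1)[OF t x] sol2(1)[OF t x])
    qed
    have w: "\<bar>E u1 t x - E u2 t x\<bar> \<le> c2 * integral {0..t} m" if x: "x \<in> {-L..L}" for x
    proof -
      have "\<bar>D.green_op (k \<eta>1 u1 \<tau>) x - D.green_op (k \<eta>2 u2 \<tau>) x\<bar> \<le> c2 * m \<tau>" if "\<tau> \<in> {0..t}" for \<tau>
      proof -
        have \<tau>: "\<tau> \<in> {0..T}"
          using that tT by auto
        show ?thesis
          unfolding D.green_op_diff[OF hc(3,4)[OF \<tau>] x] c2_def mult.assoc
          by (intro CD(2) continuous_on_diff hc \<tau> x dk)
      qed
      from integral_diff_le[OF op_t(2)[OF in1 t x] op_t(2)[OF in2 t x] m' this]
      show ?thesis
        by (simp add: sol1(2)[OF t x] sol2(2)[OF t x])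
    qed
    \<comment> \<open>Increments in space are taken in the subtracted equations, where the initial
      value cancels, and are estimated under the time integral. Hence no spatial derivative has to
      be interchanged with that integral.\<close>
    have lip: "\<bar>(E u1 t z - E u2 t z) - (E u1 t y - E u2 t y)\<bar> \<le> c3 * integral {0..t} m * (z - y)"
      if yz: "-L \<le> y" "y \<le> z" "z \<le> L" for y z
    proof -
      have y: "y \<in> {-L..L}" and z: "z \<in> {-L..L}"
        using yz by auto
      note int1 = op_t(2)[OF in1 t y] op_t(2)[OF in1 t z]
      note int2 = op_t(2)[OF in2 t y] op_t(2)[OF in2 t z]
      have "\<bar>(D.green_op (k \<eta>1 u1 \<tau>) z - D.green_op (k \<eta>2 u2 \<tau>) z)
          - (D.green_op (k \<eta>1 u1 \<tau>) y - D.green_op (k \<eta>2 u2 \<tau>) y)\<bar> \<le> c3 * (z - y) * m \<tau>" if "\<tau> \<in> {0..t}" for \<tau>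
      proof -
        have \<tau>: "\<tau> \<in> {0..T}"
          using that tT by auto
        have "\<bar>(D.green_op (k \<eta>1 u1 \<tau>) z - D.green_op (k \<eta>2 u2 \<tau>) z)
          - (D.green_op (k \<eta>1 u1 \<tau>) y - D.green_op (k \<eta>2 u2 \<tau>) y)\<bar> \<le> CL * ((1 + M) * m \<tau>) * (z - y)"
          unfolding D.green_op_diff[OF hc(3,4)[OF \<tau>] y] D.green_op_diff[OF hc(3,4)[OF \<tau>] z]
          by (intro CL(2) continuous_on_diff hc \<tau> yz dk)
        then show ?thesis
          by (simp only: c3_def mult_ac)
      qed
      from integral_diff_le[OF continuous_on_diff[OF int1(2) int2(2)] continuous_on_diff[OF int1(1) int2(1)] m' this]
      show ?thesis
        using int1 int2
        by (simp add: sol1(2)[OF t y] sol1(2)[OF t z] sol2(2)[OF t y] sol2(2)[OF t z]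
            Henstock_Kurzweil_Integration.integral_diff integrable_continuous_real mult_ac)
    qed
    \<comment> \<open>This returns control of the velocity derivative, which entered the estimate
      \<open>e\<close> through the coefficient \<open>a / b\<close>, and so closes the system of
      inequalities.\<close>
    have v: "\<bar>V u1 t x - V u2 t x\<bar> \<le> c3 * integral {0..t} m" if x: "x \<in> {-L..L}" for x
    proof -
      note s1 = H2T_sobolev[OF in1(2) t] and s2 = H2T_sobolev[OF in2(2) t]
      have "\<bar>cont_rep L (weak_deriv L 1 (\<lambda>x. u1 t x - u2 t x)) x\<bar> \<le> c3 * integral {0..t} m"
      proof (rule cont_rep_weak_deriv_le_lipschitz[OF \<open>L > 0\<close> sobolev_diff[OF s1(1) s2(1)] x])
        fix y z assume yz: "-L \<le> y" "y \<le> z" "z \<le> L"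
        then show "\<bar>cont_rep L (\<lambda>x. u1 t x - u2 t x) z - cont_rep L (\<lambda>x. u1 t x - u2 t x) y\<bar>
            \<le> c3 * integral {0..t} m * (z - y)"
          using lip[OF yz] cont_rep_diff[OF \<open>L > 0\<close> s1(2) s2(2), of y] cont_rep_diff[OF \<open>L > 0\<close> s1(2) s2(2), of z]
          by (simp add: E_def)
      qed
      then show ?thesis
        by (simp add: V_def cont_rep_weak_deriv_diff[OF \<open>L > 0\<close> s1(1) s2(1) x, simplified])
    qed
    have "c1 * integral {0..t} m \<le> C * integral {0..t} m" "c2 * integral {0..t} m \<le> C * integral {0..t} m"
      "c3 * integral {0..t} m \<le> C * integral {0..t} m"
      using c I by (auto simp: C_def intro!: mult_right_mono)
    then show ?thesis
      unfolding Q_def by (auto dest: e w v)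
  qed

  show ?thesis
  proof
    fix t assume t: "t \<in> {0..T}"
    have Q: "Q t (2 * M * (inverse (fact n) * (C * t) ^ n))" for n
      by (rule picard_iteration[OF Q0 step t])
    have "E \<eta>1 t x - E \<eta>2 t x = 0 \<and> E u1 t x - E u2 t x = 0" if "x \<in> {-L..L}" for x
    proof
      show "E \<eta>1 t x - E \<eta>2 t x = 0"
        by (rule zero_if_le_exp_terms) (use Q that in \<open>unfold Q_def, blast\<close>)
      show "E u1 t x - E u2 t x = 0"
        by (rule zero_if_le_exp_terms) (use Q that in \<open>unfold Q_def, blast\<close>)
    qed
    then have eq: "cont_rep L (\<eta>1 t) x = cont_rep L (\<eta>2 t) x" "cont_rep L (u1 t) x = cont_rep L (u2 t) x"
      if "x \<in> space (leb L)" for x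
      using that by (auto simp: E_def)
    note spec = cont_rep_spec(2)[OF \<open>L > 0\<close>]
    have "AE x in leb L. \<eta>1 t x = \<eta>2 t x"
      using spec[OF H1T_sobolev[OF in1(1) t]] spec[OF H1T_sobolev[OF in2(1) t]] AE_space
      by eventually_elim (metis eq(1))
    moreover have "AE x in leb L. u1 t x = u2 t x"
      using spec[OF H2T_sobolev(2)[OF in1(2) t]] spec[OF H2T_sobolev(2)[OF in2(2) t]] AE_space
      by eventually_elim (metis eq(2))
    ultimately show "(AE x in leb L. \<eta>1 t x = \<eta>2 t x) \<and> (AE x in leb L. u1 t x = u2 t x)" ..
  qed
qed

end
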